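(* For any $0<\delta<1$, $p\ge 2$ and $\gamma>0$, there exist constants $C_\gamma$ and $C_\gamma'$, not depending on $N$, such that $$\sup_{N\ge C_\gamma'}\ \mathbb{P}\left(\sup_{|a_n|\le 1}\Big\|\sum_{n\in S(\omega)}a_n e(nx)\Big\|_{L^p([0,1])}\ \ge\ C_\gamma\Big\|\sum_{n\in S(\omega)}e(nx)\Big\|_{L^p([0,1])}\right)\le\gamma .$$
   Context: Write $e(x)=e^{2\pi i x}$ for $x\in\mathbb{R}$. For an integer $N\ge1$, $[1,N]$ denotes the set of integers from $1$ to $N$. Given $0<\delta<1$, set $\tau=N^{-\delta}$ and let $\xi_n=\xi_n(\omega)$, $1\le n\le N$, be i.i.d. $\{0,1\}$-valued random variables with $\mathbb{P}(\xi_n=1)=\tau$ and $\mathbb{P}(\xi_n=0)=1-\tau$. The random set is $S(\omega)=\{n\in[1,N]:\xi_n(\omega)=1\}$ (it depends on $N$ and $\delta$). The supremum over $|a_n|\le1$ is over all complex sequences $(a_n)_{n\in[1,N]}$ with absolute value $|a_n|\le 1$ for every $n$. *)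

theory Defs
  imports "HOL-Probability.Probability"
begin

definition e :: "real \<Rightarrow> complex" where
  "e x = exp (2 * of_real pi * \<i> * of_real x)"

text \<open>The Bochner integral of a non-integrable function is 0, so this is the usual
  \<open>L\<^sup>p\<close> norm only for functions in \<open>L\<^sup>p([0,1])\<close>; below it is applied to
  trigonometric polynomials only.\<close>

definition Lp_norm :: "real \<Rightarrow> (real \<Rightarrow> complex) \<Rightarrow> real" where
  "Lp_norm p f = (LINT x|lebesgue_on {0..1}. cmod (f x) powr p) powr (1 / p)"

definition bernoulli_family :: "real \<Rightarrow> nat \<Rightarrow> 'w measure \<Rightarrow> (nat \<Rightarrow> 'w \<Rightarrow> nat) \<Rightarrow> bool" where
  "bernoulli_family \<tau> N M \<xi> \<longleftrightarrow>
     prob_space M \<and>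
     prob_space.indep_vars M (\<lambda>_. count_space UNIV) \<xi> {1..N} \<and>
     (\<forall>n\<in>{1..N}.
        (\<forall>\<omega>\<in>space M. \<xi> n \<omega> \<in> {0, 1}) \<and>
        measure M {\<omega>\<in>space M. \<xi> n \<omega> = 1} = \<tau> \<and>
        measure M {\<omega>\<in>space M. \<xi> n \<omega> = 0} = 1 - \<tau>)"

definition random_set :: "nat \<Rightarrow> (nat \<Rightarrow> 'w \<Rightarrow> nat) \<Rightarrow> 'w \<Rightarrow> nat set" where
  "random_set N \<xi> \<omega> = {n\<in>{1..N}. \<xi> n \<omega> = 1}"

text \<open>Values of \<open>a\<close> outside \<open>[1,N]\<close> are unconstrained but do not affect the sums over
  subsets of \<open>[1,N]\<close>.\<close>

definition unit_bounded :: "nat \<Rightarrow> (nat \<Rightarrow> complex) set" where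
  "unit_bounded N = {a. \<forall>n\<in>{1..N}. cmod (a n) \<le> 1}"

definition sup_norm_coeffs :: "real \<Rightarrow> nat \<Rightarrow> nat set \<Rightarrow> real" where
  "sup_norm_coeffs p N S =
     (SUP a\<in>unit_bounded N. Lp_norm p (\<lambda>x. \<Sum>n\<in>S. a n * e (real n * x)))"

text \<open>The real-valued supremum above is a genuine one: it ranges over a nonempty set that is
  bounded above.\<close>

lemma unit_bounded_nonempty: "unit_bounded N \<noteq> {}"
proof -
  have "(\<lambda>_. 0) \<in> unit_bounded N" by (simp add: unit_bounded_def)
  then show ?thesis by blast
qed

lemma norm_e [simp]: "cmod (e x) = 1"
  by (simp add: e_def)

lemma sup_norm_coeffs_bdd_above:
  assumes "S \<subseteq> {1..N}" "p > 0"
  shows "bdd_above ((\<lambda>a. Lp_norm p (\<lambda>x. \<Sum>n\<in>S. a n * e (real n * x))) ` unit_bounded N)"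
proof (rule bdd_aboveI2)
  fix a assume a: "a \<in> unit_bounded N"
  have le: "cmod (\<Sum>n\<in>S. a n * e (real n * x)) \<le> real (card S)" for x
  proof -
    have "cmod (\<Sum>n\<in>S. a n * e (real n * x)) \<le> (\<Sum>n\<in>S. 1)"
      using a assms(1) by (intro sum_norm_le) (auto simp: norm_mult unit_bounded_def)
    then show ?thesis by simp
  qed
  have int: "integrable (lebesgue_on {0..1::real}) (\<lambda>x. real (card S) powr p)"
    by (intro finite_measure.integrable_const finite_measure_lebesgue_on) auto
  have "(LINT x|lebesgue_on {0..1}. cmod (\<Sum>n\<in>S. a n * e (real n * x)) powr p)
        \<le> (LINT x|lebesgue_on {0..1::real}. real (card S) powr p)"
    by (rule integral_mono'[OF int]) (use le assms(2) in \<open>auto intro!: powr_mono2\<close>)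
  then show "Lp_norm p (\<lambda>x. \<Sum>n\<in>S. a n * e (real n * x))
        \<le> (LINT x|lebesgue_on {0..1::real}. real (card S) powr p) powr (1 / p)"
    unfolding Lp_norm_def using assms(2) by (intro powr_mono2) (auto intro!: integral_nonneg_AE)
qed

end

theory Submission
  imports Defs "HOL-Real_Asymp.Real_Asymp"
begin

text \<open>Write \<open>R = \<tau> N\<close> for the expected size of the random set \<open>S\<close>, and \<open>f\<close> for a polynomial
\<open>\<Sum>n\<in>S. b\<^sub>n e(n x)\<close> with coefficients of modulus at most 1. With high probability every such \<open>f\<close>
has \<open>\<integral>\<bar>f\<bar>\<^sup>p \<le> C (R\<^bsup>p/2\<^esup> + R\<^bsup>p\<^esup>/N)\<close>, and the polynomial with all coefficients 1 attains this
order: its mean square is the cardinality of \<open>S\<close>, which gives \<open>R\<^bsup>p/2\<^esup>\<close>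
(\<open>moment_ge_energy_powr\<close>), and it is of size \<open>R\<close> for \<open>\<bar>x\<bar> \<le> 1/(8N)\<close>, which gives \<open>R\<^sup>p/N\<close>
(\<open>moment_ge_near_zero\<close>).

The upper bound is read off, level by level, from the energy \<open>A\<close> that \<open>f\<close> carries where it exceeds
a level \<open>\<lambda> = K \<surd>R\<close>. For \<open>p > 2\<close> it is enough that \<open>A\<close> is at most a constant times \<open>R\<^sup>2/N\<close>, up to
an error \<open>\<lambda>\<^sup>2 K\<^bsup>-(p+1)\<^esup>\<close> (\<open>moment_le_of_energy_decay\<close>). Suppose that \<open>A\<close> is larger, and let \<open>g\<close>
be the part of \<open>f\<close> above the level. Pairing \<open>f\<close> with \<open>g\<close> gives
\<open>\<Sum>n\<in>S. \<bar>c\<^sub>n\<bar> \<ge> A\<close> for the Fourier coefficients \<open>c\<^sub>n\<close> of \<open>g\<close>. If \<open>g\<close> did not depend on \<open>S\<close>, then the expectation of this sum would be at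
most \<open>\<tau> \<surd>(N A)\<close> by Bessel and Cauchy-Schwarz, which is much less than \<open>A\<close> because \<open>A\<close> is much
larger than \<open>R\<^sup>2/N\<close>. Chernoff's bound then says that, outside an event of probability exponentially
small in \<open>y\<close>, the coefficients truncated at height \<open>A/(8y)\<close> sum to less than \<open>A/8\<close>. The rest of the
sum comes from the coefficients above that height, and there are at most \<open>y\<close> of them in \<open>S\<close>.

The dependence of \<open>g\<close> on \<open>S\<close> is removed by Maurey's empirical method. A polynomial with \<open>t\<close>
frequencies is \<open>2t\<close> times a convex combination of the functions \<open>\<i>\<^sup>k e(n x)\<close>, hence within a small
fraction of \<open>\<lambda>\<close> of an average of \<open>s = B (t/\<lambda>)\<^sup>2\<close> of them, apart from an error exponentially small
in \<open>B\<close> (\<open>word_approximation\<close>). There are only \<open>(4N)\<^sup>s\<close> averages, so \<open>y = B s\<close> leaves room for a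
union bound over all of them (\<open>word_uniform_fails_prob\<close>).

As a result, a large energy above \<open>\<lambda>\<close> of a polynomial with \<open>t\<close> frequencies in \<open>S\<close> is inherited,
with the same coefficients and up to constants, by a subpolynomial with only about \<open>B\<^sup>2 (t/\<lambda>)\<^sup>2\<close>
frequencies (\<open>sparsify\<close>). Thus the ratio of the number of frequencies to \<open>\<lambda>\<^sup>2\<close> is squared, up to
\<open>B\<^sup>2\<close>. It starts at \<open>4/K\<^sup>2\<close>, and with \<open>B = K\<^bsup>1/8\<^esup>\<close> finitely many rounds make it smaller than any
given power of \<open>1/K\<close>. By Parseval it bounds the energy that is left, which is a contradiction
(\<open>energy_large_part_bound\<close>).\<close>

section \<open>Trigonometric polynomials on the unit interval\<close>

abbreviation unit_lebesgue :: "real measure" where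
  "unit_lebesgue \<equiv> lebesgue_on {0..1}"

definition trig_poly :: "nat set \<Rightarrow> (nat \<Rightarrow> complex) \<Rightarrow> real \<Rightarrow> complex" where
  "trig_poly T b x = (\<Sum>n\<in>T. b n * e (real n * x))"

definition fourier_coeff :: "(real \<Rightarrow> complex) \<Rightarrow> nat \<Rightarrow> complex" where
  "fourier_coeff g n = (LINT x|unit_lebesgue. g x * cnj (e (real n * x)))"

definition energy :: "(real \<Rightarrow> complex) \<Rightarrow> real" where
  "energy g = (LINT x|unit_lebesgue. (cmod (g x))\<^sup>2)"

definition large_part :: "real \<Rightarrow> (real \<Rightarrow> complex) \<Rightarrow> real \<Rightarrow> complex" where
  "large_part l f x = (if cmod (f x) \<ge> l then f x else 0)"

lemma finite_measure_unit_lebesgue: "finite_measure unit_lebesgue"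
  by (rule finite_measure_lebesgue_on) auto

lemma measure_unit_lebesgue: "measure unit_lebesgue (space unit_lebesgue) = 1"
  by (simp add: measure_restrict_space)

lemma measure_unit_interval [simp]: "measure unit_lebesgue {0..1} = 1"
  using measure_unit_lebesgue by simp

lemma borel_unit_lebesgue:
  "f \<in> borel_measurable borel \<Longrightarrow> f \<in> borel_measurable unit_lebesgue"
  by (intro measurable_restrict_space1 measurable_completion) simp

lemma integrable_unit_bounded:
  fixes f :: "real \<Rightarrow> 'b::{banach,second_countable_topology}"
  assumes "f \<in> borel_measurable borel" "\<And>x. norm (f x) \<le> C"
  shows "integrable unit_lebesgue f"
  using finite_measure.integrable_const_bound[OF finite_measure_unit_lebesgue, of f C]
    borel_unit_lebesgue[OF assms(1)] assms(2) by simp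

lemma borel_e [measurable]: "(\<lambda>x. e (c * x)) \<in> borel_measurable borel"
  unfolding e_def by (intro borel_measurable_continuous_onI continuous_intros)

lemma borel_cnj [measurable (raw)]:
  "f \<in> borel_measurable M \<Longrightarrow> (\<lambda>x. cnj (f x)) \<in> borel_measurable M"
  by (rule borel_measurable_continuous_on[OF _]) (auto intro!: continuous_intros)

lemma e_mult_cnj: "e x * cnj (e y) = e (x - y)"
  by (simp add: e_def exp_cnj exp_add[symmetric] algebra_simps)

lemma integral_e_int: "(LINT x|unit_lebesgue. e (real_of_int k * x)) = (if k = 0 then 1 else 0)"
proof (cases "k = 0")
  case True
  then show ?thesis
    using measure_unit_lebesgue by (simp add: e_def)
next
  case False
  define c :: complex where "c = 2 * of_real pi * \<i> * of_int k"
  have c0: "c \<noteq> 0" using False by (simp add: c_def)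
  have ee: "e (real_of_int k * x) = exp (c * of_real x)" for x
    by (simp add: e_def c_def mult_ac)
  have der: "((\<lambda>x. exp (c * of_real x) / c) has_vector_derivative exp (c * of_real x)) (at x within {0..1})" for x
  proof -
    have "((\<lambda>z. exp (c * z) / c) has_field_derivative exp (c * of_real x)) (at (of_real x))"
      using c0 by (auto intro!: derivative_eq_intros)
    then show ?thesis
      by (intro has_vector_derivative_real_field)
  qed
  have "((\<lambda>x. exp (c * of_real x)) has_integral (exp (c * of_real 1) / c - exp (c * of_real 0) / c)) {0..1}"
    by (rule fundamental_theorem_of_calculus) (use der in auto)
  moreover have "exp (c * of_real 1) = 1"
    unfolding c_def by (auto simp: exp_eq_1 intro!: exI[of _ k])
  ultimately have "((\<lambda>x. e (real_of_int k * x)) has_integral 0) {0..1}"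
    by (simp add: ee)
  moreover have "integrable unit_lebesgue (\<lambda>x. e (real_of_int k * x))"
    by (rule integrable_unit_bounded[where C=1]) auto
  ultimately show ?thesis
    using False lebesgue_integral_eq_integral[of "{0..1}" "\<lambda>x. e (real_of_int k * x)"]
    by (simp add: integral_unique)
qed

lemma orthonormal_e:
  "(LINT x|unit_lebesgue. e (real n * x) * cnj (e (real m * x))) = (if n = m then 1 else 0)"
  using integral_e_int[of "int n - int m"] by (simp add: e_mult_cnj left_diff_distrib)

lemma borel_trig_poly [measurable]: "trig_poly T b \<in> borel_measurable borel"
  unfolding trig_poly_def by measurable

lemma trig_poly_bound:
  assumes "\<And>n. n \<in> T \<Longrightarrow> cmod (b n) \<le> 1"
  shows "cmod (trig_poly T b x) \<le> card T"
proof -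
  have "cmod (trig_poly T b x) \<le> (\<Sum>n\<in>T. 1)"
    unfolding trig_poly_def using assms by (intro sum_norm_le) (auto simp: norm_mult)
  then show ?thesis by simp
qed

lemma trig_poly_bound': "cmod (trig_poly T b x) \<le> (\<Sum>n\<in>T. cmod (b n))"
  unfolding trig_poly_def by (intro sum_norm_le) (auto simp: norm_mult)

lemma borel_large_part [measurable]:
  assumes [measurable]: "f \<in> borel_measurable borel"
  shows "large_part l f \<in> borel_measurable borel"
  unfolding large_part_def by measurable

lemma large_part_bound: "cmod (large_part l f x) \<le> cmod (f x)"
  by (simp add: large_part_def)

lemma integrable_fourier:
  assumes [measurable]: "g \<in> borel_measurable borel" and "\<And>x. cmod (g x) \<le> C"
  shows "integrable unit_lebesgue (\<lambda>x. g x * cnj (e (real n * x)))"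
    and "integrable unit_lebesgue (\<lambda>x. cnj (g x) * e (real n * x))"
  using assms(2) by (auto intro!: integrable_unit_bounded[where C=C] simp: norm_mult)

lemma pairing_trig_poly:
  assumes [measurable]: "g \<in> borel_measurable borel" and g: "\<And>x. cmod (g x) \<le> C"
  shows "(LINT x|unit_lebesgue. trig_poly T b x * cnj (g x)) = (\<Sum>n\<in>T. b n * cnj (fourier_coeff g n))"
proof -
  have coeff: "(LINT x|unit_lebesgue. cnj (g x) * e (real n * x)) = cnj (fourier_coeff g n)" for n
  proof -
    have "(LINT x|unit_lebesgue. cnj (g x * cnj (e (real n * x))))
        = cnj (LINT x|unit_lebesgue. g x * cnj (e (real n * x)))"
      by (rule Bochner_Integration.integral_cnj)
    then show ?thesis
      unfolding fourier_coeff_def complex_cnj_mult complex_cnj_cnj .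
  qed
  have "(LINT x|unit_lebesgue. trig_poly T b x * cnj (g x))
      = (LINT x|unit_lebesgue. (\<Sum>n\<in>T. b n * (cnj (g x) * e (real n * x))))"
    by (simp add: trig_poly_def sum_distrib_left mult_ac)
  also have "\<dots> = (\<Sum>n\<in>T. b n * (LINT x|unit_lebesgue. cnj (g x) * e (real n * x)))"
    using integrable_fourier(2)[OF assms] by (subst Bochner_Integration.integral_sum) auto
  finally show ?thesis unfolding coeff .
qed

lemma fourier_coeff_trig_poly:
  assumes "finite T"
  shows "fourier_coeff (trig_poly T b) n = (if n \<in> T then b n else 0)"
proof -
  have "fourier_coeff (trig_poly T b) n
      = (LINT x|unit_lebesgue. (\<Sum>m\<in>T. b m * (e (real m * x) * cnj (e (real n * x)))))"
    by (simp add: fourier_coeff_def trig_poly_def sum_distrib_left mult_ac)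
  also have "\<dots> = (\<Sum>m\<in>T. b m * (LINT x|unit_lebesgue. e (real m * x) * cnj (e (real n * x))))"
    by (subst Bochner_Integration.integral_sum)
      (auto intro!: integrable_fourier(1)[where C=1])
  also have "\<dots> = (\<Sum>m\<in>T. if m = n then b m else 0)"
    by (auto simp: orthonormal_e intro!: sum.cong)
  finally show ?thesis using assms by simp
qed

lemma energy_eq_Re: "(LINT x|unit_lebesgue. f x * cnj (f x)) = of_real (energy f)"
  unfolding energy_def complex_norm_square[symmetric] of_real_power[symmetric] integral_complex_of_real ..

lemma energy_trig_poly:
  assumes "finite T"
  shows "energy (trig_poly T b) = (\<Sum>n\<in>T. (cmod (b n))\<^sup>2)"
proof -
  have "complex_of_real (energy (trig_poly T b)) = (\<Sum>n\<in>T. b n * cnj (fourier_coeff (trig_poly T b) n))"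
    unfolding energy_eq_Re[symmetric]
    by (rule pairing_trig_poly[OF _ trig_poly_bound']) measurable
  also have "\<dots> = of_real (\<Sum>n\<in>T. (cmod (b n))\<^sup>2)"
    using assms by (auto simp: fourier_coeff_trig_poly complex_norm_square of_real_sum
        simp del: of_real_power intro!: sum.cong)
  finally show ?thesis using of_real_eq_iff by blast
qed

lemma integrable_energy:
  assumes [measurable]: "g \<in> borel_measurable borel" and g: "\<And>x. cmod (g x) \<le> C"
  shows "integrable unit_lebesgue (\<lambda>x. (cmod (g x))\<^sup>2)"
  using g by (intro integrable_unit_bounded[where C="C\<^sup>2"]) (auto intro!: power_mono)

lemma energy_nonneg [simp]: "0 \<le> energy g"
  unfolding energy_def by (intro integral_nonneg_AE) auto

text \<open>The integral of \<open>\<bar>g - P\<bar>\<^sup>2\<close> is nonnegative, where \<open>P\<close> is the partial Fourier sum of \<open>g\<close>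
  over \<open>T\<close>.\<close>

lemma bessel:
  assumes m [measurable]: "g \<in> borel_measurable borel" and g: "\<And>x. cmod (g x) \<le> C" and "finite T"
  shows "(\<Sum>n\<in>T. (cmod (fourier_coeff g n))\<^sup>2) \<le> energy g"
proof -
  define P where "P = trig_poly T (fourier_coeff g)"
  define D where "D = (\<Sum>n\<in>T. cmod (fourier_coeff g n))"
  have [measurable]: "P \<in> borel_measurable borel" by (simp add: P_def)
  have P: "cmod (P x) \<le> D" for x
    unfolding P_def D_def by (rule trig_poly_bound')
  have D0: "0 \<le> D" unfolding D_def by (simp add: sum_nonneg)
  have iPg: "integrable unit_lebesgue (\<lambda>x. P x * cnj (g x))"
    using P g D0 by (intro integrable_unit_bounded[where C="D * C"]) (auto simp: norm_mult intro!: mult_mono)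
  have Pg: "(LINT x|unit_lebesgue. P x * cnj (g x)) = of_real (\<Sum>n\<in>T. (cmod (fourier_coeff g n))\<^sup>2)"
    unfolding P_def pairing_trig_poly[OF m g] of_real_sum complex_norm_square ..
  define r where "r x = Re (P x * cnj (g x))" for x
  have ir: "integrable unit_lebesgue r"
    unfolding r_def[abs_def] by (rule integrable_Re[OF iPg])
  have r_eq: "(LINT x|unit_lebesgue. r x) = Re (LINT x|unit_lebesgue. P x * cnj (g x))"
    unfolding r_def by (rule integral_Re[OF iPg])
  have iP: "integrable unit_lebesgue (\<lambda>x. (cmod (P x))\<^sup>2)"
    by (rule integrable_energy[OF _ P]) measurable
  have "0 \<le> (LINT x|unit_lebesgue. (cmod (g x - P x))\<^sup>2)"
    by (intro integral_nonneg_AE) auto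
  also have "(\<lambda>x. (cmod (g x - P x))\<^sup>2) = (\<lambda>x. (cmod (g x))\<^sup>2 + (cmod (P x))\<^sup>2 - 2 * r x)"
    unfolding cmod_power2 r_def by (simp add: power2_eq_square algebra_simps)
  also have "(LINT x|unit_lebesgue. (cmod (g x))\<^sup>2 + (cmod (P x))\<^sup>2 - 2 * r x)
      = energy g + energy P - 2 * Re (LINT x|unit_lebesgue. P x * cnj (g x))"
    using ir iP integrable_energy[OF m g] by (simp add: energy_def r_eq)
  also have "\<dots> = energy g - (\<Sum>n\<in>T. (cmod (fourier_coeff g n))\<^sup>2)"
    using Pg assms(3) by (simp add: energy_trig_poly P_def)
  finally show ?thesis by simp
qed

section \<open>Sparse approximation by greedy sampling\<close>

lemma exp_le_add_exp_square: "exp (z::real) \<le> z + exp (z\<^sup>2)"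
proof -
  have sq: "1 + z\<^sup>2 \<le> exp (z\<^sup>2)" by (rule exp_ge_add_one_self)
  consider "z < -1" | "-1 \<le> z" "z \<le> 0" | "0 \<le> z" "z \<le> 1" | "1 < z" by linarith
  then show ?thesis
  proof cases
    case 1
    then have "exp z \<le> 1" "- z \<le> z\<^sup>2"
      using mult_left_mono[of 1 "-z" "-z"] by (auto simp: power2_eq_square)
    with sq show ?thesis by linarith
  next
    case 2
    define y where "y = - z"
    have y: "0 \<le> y" "y \<le> 1" using 2 by (auto simp: y_def)
    have "1 \<le> 1 + y * y * y" using y by simp
    also have "\<dots> = (1 + y) * (1 - y + y\<^sup>2)" by (simp add: algebra_simps power2_eq_square)
    also have "\<dots> \<le> exp y * (1 - y + y\<^sup>2)"
      using y exp_ge_add_one_self[of y] by (intro mult_right_mono) auto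
    finally have "exp z \<le> 1 - y + y\<^sup>2"
      by (simp add: y_def exp_minus field_simps)
    then have "exp z \<le> z + (1 + z\<^sup>2)" by (simp add: y_def)
    also have "\<dots> \<le> z + exp (z\<^sup>2)" by (rule add_left_mono[OF sq])
    finally show ?thesis .
  next
    case 3
    have "exp z \<le> z + (1 + z\<^sup>2)" using exp_bound[OF 3] by simp
    also have "\<dots> \<le> z + exp (z\<^sup>2)" by (rule add_left_mono[OF sq])
    finally show ?thesis .
  next
    case 4
    then have "z \<le> z\<^sup>2" by (simp add: power2_eq_square)
    then have "exp z \<le> exp (z\<^sup>2)" by simp
    with 4 show ?thesis by linarith
  qed
qed

text \<open>A bound for the moment generating function of a centred variable with finitely many values. The
  linear term of \<open>exp z \<le> z + exp (z\<^sup>2)\<close> averages to 0.\<close>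

lemma weighted_exp_le:
  fixes d q :: "'i \<Rightarrow> real"
  assumes "\<And>i. i \<in> I \<Longrightarrow> 0 \<le> q i" "sum q I = 1" "(\<Sum>i\<in>I. q i * d i) = 0"
    "\<And>i. i \<in> I \<Longrightarrow> \<bar>d i\<bar> \<le> D"
  shows "(\<Sum>i\<in>I. q i * exp (c * d i)) \<le> exp (c\<^sup>2 * D\<^sup>2)"
proof -
  have "(\<Sum>i\<in>I. q i * exp (c * d i)) \<le> (\<Sum>i\<in>I. c * (q i * d i) + q i * exp (c\<^sup>2 * D\<^sup>2))"
  proof (rule sum_mono)
    fix i assume i: "i \<in> I"
    have "exp (c * d i) \<le> c * d i + exp ((c * d i)\<^sup>2)" by (rule exp_le_add_exp_square)
    also have "(c * d i)\<^sup>2 \<le> c\<^sup>2 * D\<^sup>2"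
      using assms(4)[OF i] by (simp add: power_mult_distrib mult_left_mono power2_le_iff_abs_le)
    finally have "exp (c * d i) \<le> c * d i + exp (c\<^sup>2 * D\<^sup>2)" by simp
    from mult_left_mono[OF this assms(1)[OF i]]
    show "q i * exp (c * d i) \<le> c * (q i * d i) + q i * exp (c\<^sup>2 * D\<^sup>2)"
      by (simp add: algebra_simps)
  qed
  also have "\<dots> = exp (c\<^sup>2 * D\<^sup>2)"
    using assms(2,3) by (simp add: sum.distrib flip: sum_distrib_left sum_distrib_right)
  finally show ?thesis .
qed

lemma weighted_cosh_le:
  fixes d q :: "'i \<Rightarrow> real"
  assumes "\<And>i. i \<in> I \<Longrightarrow> 0 \<le> q i" "sum q I = 1" "(\<Sum>i\<in>I. q i * d i) = 0"
    "\<And>i. i \<in> I \<Longrightarrow> \<bar>d i\<bar> \<le> D"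
  shows "(\<Sum>i\<in>I. q i * cosh (c * (a + d i))) \<le> cosh (c * a) * exp (c\<^sup>2 * D\<^sup>2)"
proof -
  have "(\<Sum>i\<in>I. q i * cosh (c * (a + d i)))
      = exp (c * a) / 2 * (\<Sum>i\<in>I. q i * exp (c * d i))
        + exp (- c * a) / 2 * (\<Sum>i\<in>I. q i * exp ((- c) * d i))"
    by (simp add: cosh_def sum_distrib_left sum.distrib[symmetric] exp_add[symmetric] algebra_simps
        add_divide_distrib)
  also have "\<dots> \<le> exp (c * a) / 2 * exp (c\<^sup>2 * D\<^sup>2) + exp (- c * a) / 2 * exp (c\<^sup>2 * D\<^sup>2)"
    using weighted_exp_le[OF assms, of c] weighted_exp_le[OF assms, of "- c"]
    by (intro add_mono mult_left_mono) auto
  also have "\<dots> = cosh (c * a) * exp (c\<^sup>2 * D\<^sup>2)"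
    by (simp add: cosh_def field_simps)
  finally show ?thesis .
qed

lemma weighted_le_imp_ex_le:
  fixes q v :: "'i \<Rightarrow> real"
  assumes "\<And>i. i \<in> I \<Longrightarrow> 0 \<le> q i" "sum q I = 1" "(\<Sum>i\<in>I. q i * v i) \<le> V"
  shows "\<exists>i\<in>I. v i \<le> V"
proof (rule ccontr)
  assume "\<not> ?thesis"
  then have v: "\<And>i. i \<in> I \<Longrightarrow> V < v i" by auto
  obtain j where j: "j \<in> I" "0 < q j"
    using assms(1,2) by (metis less_eq_real_def sum.neutral zero_neq_one)
  have "finite I" using assms(2) by (metis sum.infinite zero_neq_one)
  moreover have "\<forall>i\<in>I. q i * V \<le> q i * v i"
    using assms(1) less_imp_le[OF v] by (auto intro!: mult_left_mono)
  moreover have "\<exists>i\<in>I. q i * V < q i * v i"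
    using j v[OF j(1)] by (intro bexI[OF _ j(1)] mult_strict_left_mono)
  ultimately have "(\<Sum>i\<in>I. q i * V) < (\<Sum>i\<in>I. q i * v i)"
    by (rule sum_strict_mono_ex1)
  then show False using assms(2,3) by (simp flip: sum_distrib_right)
qed

text \<open>The potential that controls the greedy choice below. One hyperbolic cosine for each of the real and
  the imaginary part bounds \<open>exp \<bar>h\<bar>\<close>, up to a rescaling of the exponent.\<close>

definition cosh_potential :: "real \<Rightarrow> (real \<Rightarrow> complex) \<Rightarrow> real" where
  "cosh_potential c h = (LINT x|unit_lebesgue. cosh (c * Re (h x)) + cosh (c * Im (h x)))"

lemma cosh_le_exp_abs: "cosh (y::real) \<le> exp \<bar>y\<bar>"
  by (auto simp: cosh_def abs_if)

lemma cosh_le_exp_bound: "\<bar>y\<bar> \<le> C \<Longrightarrow> cosh (y::real) \<le> exp C"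
  using cosh_le_exp_abs[of y] by (meson exp_le_cancel_iff order_trans)

lemma borel_cosh [measurable]: "(cosh :: real \<Rightarrow> real) \<in> borel_measurable borel"
  by (intro borel_measurable_continuous_onI continuous_intros)

lemma integrable_cosh:
  assumes [measurable]: "h \<in> borel_measurable borel" and h: "\<And>x. cmod (h x) \<le> C"
  shows "integrable unit_lebesgue (\<lambda>x. cosh (c * Re (h x)) + cosh (c * Im (h x)))"
proof (rule integrable_unit_bounded[where C="exp (\<bar>c\<bar> * C) + exp (\<bar>c\<bar> * C)"])
  fix x
  have "\<bar>Re (h x)\<bar> \<le> C" "\<bar>Im (h x)\<bar> \<le> C"
    using h[of x] abs_Re_le_cmod[of "h x"] abs_Im_le_cmod[of "h x"] by linarith+
  then have "cosh (c * Re (h x)) \<le> exp (\<bar>c\<bar> * C)" "cosh (c * Im (h x)) \<le> exp (\<bar>c\<bar> * C)"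
    by (auto intro!: cosh_le_exp_bound simp: abs_mult mult_left_mono)
  then show "norm (cosh (c * Re (h x)) + cosh (c * Im (h x))) \<le> exp (\<bar>c\<bar> * C) + exp (\<bar>c\<bar> * C)"
    using cosh_real_pos[of "c * Re (h x)"] cosh_real_pos[of "c * Im (h x)"] by simp
qed measurable

text \<open>Maurey's empirical method, made deterministic. If \<open>i\<close> is drawn with the weights \<open>q\<close>, then
  \<open>F - X i\<close> has mean 0 at every point, so that adding it to a partial sum \<open>h\<close> multiplies the
  potential of \<open>h\<close> by at most \<open>exp (c\<^sup>2 D\<^sup>2)\<close> on average. Some choice of \<open>i\<close> does no worse than the
  average, and the letters of the word are chosen in this way one after the other.\<close>

lemma maurey_greedy:
  fixes q :: "'i \<Rightarrow> real" and X :: "'i \<Rightarrow> real \<Rightarrow> complex"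
  assumes q: "\<And>i. i \<in> I \<Longrightarrow> 0 \<le> q i" "sum q I = 1"
    and F: "\<And>x. F x = (\<Sum>i\<in>I. of_real (q i) * X i x)"
    and mX [measurable]: "\<And>i. X i \<in> borel_measurable borel"
    and D: "\<And>i x. i \<in> I \<Longrightarrow> cmod (F x - X i x) \<le> D"
  shows "\<exists>w. length w = s \<and> set w \<subseteq> I \<and>
    cosh_potential c (\<lambda>x. \<Sum>i\<leftarrow>w. F x - X i x) \<le> 2 * exp (real s * (c\<^sup>2 * D\<^sup>2))"
proof (induction s)
  case 0
  show ?case by (simp add: cosh_potential_def)
next
  case (Suc s)
  then obtain w where w: "length w = s" "set w \<subseteq> I"
    and le: "cosh_potential c (\<lambda>x. \<Sum>i\<leftarrow>w. F x - X i x) \<le> 2 * exp (real s * (c\<^sup>2 * D\<^sup>2))"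
    by blast
  define h where "h x = (\<Sum>i\<leftarrow>w. F x - X i x)" for x
  have [measurable]: "F \<in> borel_measurable borel"
    using F by (simp add: measurable_cong[of borel F])
  have mh [measurable]: "h \<in> borel_measurable borel"
    unfolding h_def[abs_def] by (induction w) auto
  have hb: "cmod (h x) \<le> real s * D" for x
    using w unfolding h_def
  proof (induction w arbitrary: s)
    case (Cons a w)
    from Cons.prems Cons.IH[of "s - 1"] D[of a x]
      norm_triangle_ineq[of "F x - X a x" "\<Sum>i\<leftarrow>w. F x - X i x"]
    show ?case by (auto simp: algebra_simps of_nat_diff)
  qed simp
  have sb: "cmod (h x + (F x - X i x)) \<le> real s * D + D" if "i \<in> I" for i x
    using hb[of x] D[OF that, of x] norm_triangle_ineq[of "h x" "F x - X i x"] by linarith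
  have zero: "(\<Sum>i\<in>I. of_real (q i) * (F x - X i x)) = 0" for x
    using q(2) F[of x]
    by (simp add: right_diff_distrib sum_subtractf flip: sum_distrib_right of_real_sum)
  have zRe: "(\<Sum>i\<in>I. q i * Re (F x - X i x)) = 0" for x
    using arg_cong[OF zero[of x], of Re] by simp
  have zIm: "(\<Sum>i\<in>I. q i * Im (F x - X i x)) = 0" for x
    using arg_cong[OF zero[of x], of Im] by simp
  have dRe: "\<bar>Re (F x - X i x)\<bar> \<le> D" "\<bar>Im (F x - X i x)\<bar> \<le> D" if "i \<in> I" for i x
    using abs_Re_le_cmod[of "F x - X i x"] abs_Im_le_cmod[of "F x - X i x"] D[OF that, of x] by linarith+
  let ?V = "\<lambda>i x. cosh (c * Re (h x + (F x - X i x))) + cosh (c * Im (h x + (F x - X i x)))"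
  have int: "integrable unit_lebesgue (?V i)" if "i \<in> I" for i
    by (rule integrable_cosh[OF _ sb[OF that]]) measurable
  have "(\<Sum>i\<in>I. q i * cosh_potential c (\<lambda>x. h x + (F x - X i x)))
      = (LINT x|unit_lebesgue. (\<Sum>i\<in>I. q i * ?V i x))"
    unfolding cosh_potential_def using int
    by (subst Bochner_Integration.integral_sum) auto
  also have "\<dots> \<le> (LINT x|unit_lebesgue. (cosh (c * Re (h x)) + cosh (c * Im (h x))) * exp (c\<^sup>2 * D\<^sup>2))"
  proof (rule integral_mono)
    show "integrable unit_lebesgue (\<lambda>x. \<Sum>i\<in>I. q i * ?V i x)"
      using int by (intro Bochner_Integration.integrable_sum) auto
    show "integrable unit_lebesgue (\<lambda>x. (cosh (c * Re (h x)) + cosh (c * Im (h x))) * exp (c\<^sup>2 * D\<^sup>2))"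
      using integrable_cosh[OF mh hb] by simp
    fix x
    have "(\<Sum>i\<in>I. q i * ?V i x)
      = (\<Sum>i\<in>I. q i * cosh (c * (Re (h x) + Re (F x - X i x))))
        + (\<Sum>i\<in>I. q i * cosh (c * (Im (h x) + Im (F x - X i x))))"
      by (simp add: distrib_left sum.distrib)
    also have "\<dots> \<le> cosh (c * Re (h x)) * exp (c\<^sup>2 * D\<^sup>2) + cosh (c * Im (h x)) * exp (c\<^sup>2 * D\<^sup>2)"
      by (intro add_mono weighted_cosh_le q zRe zIm dRe)
    finally show "(\<Sum>i\<in>I. q i * ?V i x) \<le> (cosh (c * Re (h x)) + cosh (c * Im (h x))) * exp (c\<^sup>2 * D\<^sup>2)"
      by (simp add: distrib_right)
  qed
  also have "\<dots> = cosh_potential c h * exp (c\<^sup>2 * D\<^sup>2)"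
    unfolding cosh_potential_def by simp
  also have "\<dots> \<le> 2 * exp (real s * (c\<^sup>2 * D\<^sup>2)) * exp (c\<^sup>2 * D\<^sup>2)"
    using le by (intro mult_right_mono) (auto simp: h_def[abs_def])
  also have "\<dots> = 2 * exp (real (Suc s) * (c\<^sup>2 * D\<^sup>2))"
    by (simp add: algebra_simps flip: exp_add)
  finally obtain i where i: "i \<in> I"
    "cosh_potential c (\<lambda>x. h x + (F x - X i x)) \<le> 2 * exp (real (Suc s) * (c\<^sup>2 * D\<^sup>2))"
    using weighted_le_imp_ex_le[of I q "\<lambda>i. cosh_potential c (\<lambda>x. h x + (F x - X i x))"
        "2 * exp (real (Suc s) * (c\<^sup>2 * D\<^sup>2))"] q by blast
  show ?case
    using i w by (intro exI[of _ "i # w"]) (auto simp: h_def[abs_def] add.commute)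
qed

section \<open>Passing to few frequencies\<close>

text \<open>The letters are the extreme points of a convex body that contains all polynomials with \<open>t\<close>
  frequencies and coefficients in the unit disc. The factor is \<open>2 t\<close> and not \<open>t\<close> because the unit
  disc lies in twice the convex hull of the powers of \<open>\<i>\<close>, with the explicit weights of the lemmas
  \<open>disc_average\<close> and \<open>disc_weights\<close>.\<close>

definition letter :: "nat \<Rightarrow> nat \<times> nat \<Rightarrow> real \<Rightarrow> complex" where
  "letter t i x = of_nat (2 * t) * \<i> ^ snd i * e (real (fst i) * x)"

definition word_poly :: "nat \<Rightarrow> (nat \<times> nat) list \<Rightarrow> real \<Rightarrow> complex" where
  "word_poly t w x = (\<Sum>i\<leftarrow>w. letter t i x) / of_nat (length w)"

lemma borel_letter [measurable]: "letter t i \<in> borel_measurable borel"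
  unfolding letter_def by measurable

lemma borel_word_poly [measurable]: "word_poly t w \<in> borel_measurable borel"
proof -
  have [measurable]: "(\<lambda>x. \<Sum>i\<leftarrow>w. letter t i x) \<in> borel_measurable borel"
    by (induction w) auto
  show ?thesis unfolding word_poly_def by measurable
qed

lemma norm_letter: "cmod (letter t i x) = 2 * real t"
  by (simp add: letter_def norm_mult norm_power)

lemma word_poly_bound: "cmod (word_poly t w x) \<le> 2 * real t"
proof -
  have "cmod (\<Sum>i\<leftarrow>w. letter t i x) \<le> real (length w) * (2 * real t)"
  proof (induction w)
    case (Cons a w)
    then show ?case
      using norm_triangle_ineq[of "letter t a x" "\<Sum>i\<leftarrow>w. letter t i x"]
      by (simp add: norm_letter algebra_simps)
  qed simp
  then show ?thesis
    by (cases "w = []") (auto simp: word_poly_def norm_divide divide_le_eq mult.commute)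
qed

lemma disc_average:
  "(\<Sum>k<4. of_real (1 + Re (z * cnj (\<i> ^ k))) * \<i> ^ k) = 2 * (z :: complex)"
  by (simp add: numeral_eq_Suc complex_eq_iff)

lemma disc_weights: "(\<Sum>k<4. 1 + Re (z * cnj (\<i> ^ k))) = 4"
  by (simp add: numeral_eq_Suc)

lemma square_le_exp: "0 \<le> u \<Longrightarrow> u\<^sup>2 \<le> 2 * exp (u::real)"
  using exp_lower_Taylor_quadratic[of u] by simp

lemma exp_cmod_le_cosh:
  assumes "0 < v"
  shows "exp (cmod z / v) \<le> 2 * (cosh (2 / v * Re z) + cosh (2 / v * Im z))"
proof -
  have *: "exp (2 / v * \<bar>r\<bar>) \<le> 2 * cosh (2 / v * r)" for r
  proof -
    have "exp (2 / v * \<bar>r\<bar>) \<le> exp (2 / v * r) + exp (- (2 / v * r))"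
      using exp_gt_zero[of "2 / v * r"] exp_gt_zero[of "- (2 / v * r)"] by (cases "0 \<le> r") auto
    then show ?thesis by (simp add: cosh_def)
  qed
  define m where "m = max \<bar>Re z\<bar> \<bar>Im z\<bar>"
  have "cmod z \<le> 2 * m" unfolding m_def using cmod_le[of z] by linarith
  then have "exp (cmod z / v) \<le> exp (2 / v * m)"
    using assms by (simp add: divide_right_mono)
  also have "\<dots> \<le> exp (2 / v * \<bar>Re z\<bar>) + exp (2 / v * \<bar>Im z\<bar>)"
    using exp_gt_zero[of "2 / v * \<bar>Re z\<bar>"] exp_gt_zero[of "2 / v * \<bar>Im z\<bar>"]
    unfolding m_def max_def by auto
  also have "\<dots> \<le> 2 * cosh (2 / v * Re z) + 2 * cosh (2 / v * Im z)"
    by (intro add_mono *)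
  finally show ?thesis by simp
qed

text \<open>Only the energy of the approximation error above a threshold is recorded. At and below a threshold
  that is a fraction of the level under study, the error is harmless, and the part above is exponentially small.\<close>

definition excess :: "real \<Rightarrow> (real \<Rightarrow> complex) \<Rightarrow> real" where
  "excess l h = (LINT x|unit_lebesgue. (max 0 (cmod (h x) - l))\<^sup>2)"

lemma integrable_excess:
  assumes [measurable]: "h \<in> borel_measurable borel" and h: "\<And>x. cmod (h x) \<le> C" and "0 \<le> l"
  shows "integrable unit_lebesgue (\<lambda>x. (max 0 (cmod (h x) - l))\<^sup>2)"
proof (rule integrable_unit_bounded[where C="C\<^sup>2"])
  fix x
  have "\<bar>max 0 (cmod (h x) - l)\<bar> \<le> C"
    using h[of x] assms(3) order_trans[OF norm_ge_zero h[of x]] by (simp add: max_def)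
  then have "\<bar>max 0 (cmod (h x) - l)\<bar>\<^sup>2 \<le> C\<^sup>2" by (intro power_mono) auto
  then show "norm ((max 0 (cmod (h x) - l))\<^sup>2) \<le> C\<^sup>2" by simp
qed measurable

text \<open>With \<open>u = (\<bar>h\<bar> - l)/v\<close>, which is positive where there is an excess, this is
  \<open>u\<^sup>2 \<le> 2 exp u\<close> integrated over the interval. The scale \<open>v\<close> is free and is optimised later.\<close>

lemma excess_le_cosh_potential:
  assumes m [measurable]: "h \<in> borel_measurable borel" and h: "\<And>x. cmod (h x) \<le> C"
    and "0 \<le> l" "0 < v"
  shows "excess l h \<le> 4 * v\<^sup>2 * exp (- l / v) * cosh_potential (2 / v) h"
proof -
  have "excess l h \<le> (LINT x|unit_lebesgue. 4 * v\<^sup>2 * exp (- l / v) *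
      (cosh (2 / v * Re (h x)) + cosh (2 / v * Im (h x))))"
    unfolding excess_def
  proof (rule integral_mono)
    show "integrable unit_lebesgue (\<lambda>x. (max 0 (cmod (h x) - l))\<^sup>2)"
      by (rule integrable_excess[OF m h assms(3)])
    show "integrable unit_lebesgue (\<lambda>x. 4 * v\<^sup>2 * exp (- l / v) *
      (cosh (2 / v * Re (h x)) + cosh (2 / v * Im (h x))))"
      using integrable_cosh[OF m h, of "2 / v"] by simp
    fix x
    define u where "u = max 0 (cmod (h x) - l) / v"
    have u0: "0 \<le> u" using assms(4) by (simp add: u_def)
    have c0: "0 \<le> cosh (2 / v * Re (h x)) + cosh (2 / v * Im (h x))"
      using cosh_real_pos[of "2 / v * Re (h x)"] cosh_real_pos[of "2 / v * Im (h x)"] by linarith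
    show "(max 0 (cmod (h x) - l))\<^sup>2 \<le> 4 * v\<^sup>2 * exp (- l / v) *
      (cosh (2 / v * Re (h x)) + cosh (2 / v * Im (h x)))"
    proof (cases "cmod (h x) \<le> l")
      case True
      then show ?thesis using c0 by (simp add: max_def)
    next
      case False
      then have u: "u = cmod (h x) / v + (- l / v)" by (simp add: u_def max_def diff_divide_distrib)
      have "(max 0 (cmod (h x) - l))\<^sup>2 = v\<^sup>2 * u\<^sup>2"
        using assms(4) by (simp add: u_def power_divide)
      also have "\<dots> \<le> v\<^sup>2 * (2 * exp u)"
        using square_le_exp[OF u0] by (intro mult_left_mono) auto
      also have "\<dots> = 2 * v\<^sup>2 * exp (- l / v) * exp (cmod (h x) / v)"
        unfolding u exp_add by (simp add: mult_ac)
      also have "\<dots> \<le> 2 * v\<^sup>2 * exp (- l / v) *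
          (2 * (cosh (2 / v * Re (h x)) + cosh (2 / v * Im (h x))))"
        by (intro mult_left_mono exp_cmod_le_cosh assms) auto
      finally show ?thesis by (simp add: algebra_simps)
    qed
  qed
  then show ?thesis by (simp add: cosh_potential_def)
qed

text \<open>The word has \<open>s\<close> letters and the error of each letter is at most \<open>3 t\<close>, so the average behaves
  like a Gaussian error of size \<open>t / \<surd>s\<close>. For \<open>s\<close> much larger than \<open>(t / l)\<^sup>2\<close> a suitable \<open>v\<close>
  makes the bound exponentially small.\<close>

lemma word_approximation:
  assumes "finite T" "T \<noteq> {}" and b: "\<And>n. n \<in> T \<Longrightarrow> cmod (b n) \<le> 1"
    and "1 \<le> s" "0 < v" "0 \<le> l"
  defines "t \<equiv> card T"
  shows "\<exists>w. length w = s \<and> set w \<subseteq> T \<times> {..<4} \<and>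
    excess l (\<lambda>x. trig_poly T b x - word_poly t w x)
      \<le> 8 * v\<^sup>2 * exp (36 * (real t)\<^sup>2 / (v\<^sup>2 * real s) - l / v)"
proof -
  have t: "0 < t" using assms by (simp add: t_def card_gt_0_iff)
  define I where "I = T \<times> {..<4::nat}"
  define q where "q i = (1 + Re (b (fst i) * cnj (\<i> ^ snd i))) / (4 * real t)" for i :: "nat \<times> nat"
  define F where "F = trig_poly T b"
  have q0: "0 \<le> q i" if "i \<in> I" for i
  proof -
    have "cmod (b (fst i) * cnj (\<i> ^ snd i)) \<le> 1"
      using that b by (auto simp: I_def norm_mult norm_power)
    then have "- 1 \<le> Re (b (fst i) * cnj (\<i> ^ snd i))"
      using abs_Re_le_cmod[of "b (fst i) * cnj (\<i> ^ snd i)"] by linarith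
    then show ?thesis unfolding q_def by simp
  qed
  have q1: "sum q I = 1"
  proof -
    have "sum q I = (\<Sum>n\<in>T. \<Sum>k<4. (1 + Re (b n * cnj (\<i> ^ k))) / (4 * real t))"
      unfolding I_def q_def by (simp add: sum.cartesian_product split_beta)
    also have "\<dots> = (\<Sum>n\<in>T. 4 / (4 * real t))"
      unfolding sum_divide_distrib[symmetric] disc_weights ..
    finally show ?thesis using t by (simp add: t_def)
  qed
  have FX: "F x = (\<Sum>i\<in>I. of_real (q i) * letter t i x)" for x
  proof -
    have "(\<Sum>i\<in>I. of_real (q i) * letter t i x)
      = (\<Sum>n\<in>T. \<Sum>k<4. of_real ((1 + Re (b n * cnj (\<i> ^ k))) / (4 * real t)) * letter t (n, k) x)"
      unfolding I_def q_def by (simp add: sum.cartesian_product split_beta)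
    also have "\<dots> = (\<Sum>n\<in>T. (\<Sum>k<4. of_real (1 + Re (b n * cnj (\<i> ^ k))) * \<i> ^ k) * (e (real n * x) / 2))"
      unfolding sum_distrib_right using t by (intro sum.cong refl) (simp add: letter_def)
    also have "\<dots> = F x"
      unfolding disc_average F_def trig_poly_def by simp
    finally show ?thesis ..
  qed
  have Fb: "cmod (F x) \<le> real t" for x
    unfolding F_def t_def by (rule trig_poly_bound[OF b])
  have D: "cmod (F x - letter t i x) \<le> 3 * real t" for i x
    using norm_triangle_ineq4[of "F x" "letter t i x"] Fb[of x] norm_letter[of t i x] by linarith
  obtain w where w: "length w = s" "set w \<subseteq> I"
    and pot: "cosh_potential (2 / (v * real s)) (\<lambda>x. \<Sum>i\<leftarrow>w. F x - letter t i x)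
      \<le> 2 * exp (real s * ((2 / (v * real s))\<^sup>2 * (3 * real t)\<^sup>2))"
    using maurey_greedy[OF q0 q1 FX borel_letter D] by blast
  define h where "h x = F x - word_poly t w x" for x
  have s0: "0 < real s" using assms(4) by simp
  have "(\<Sum>i\<leftarrow>w. F x - letter t i x) = of_nat (length w) * F x - (\<Sum>i\<leftarrow>w. letter t i x)" for x
    by (induction w) (auto simp: algebra_simps)
  then have sum_h: "(\<Sum>i\<leftarrow>w. F x - letter t i x) = of_real (real s) * h x" for x
    using s0 w by (simp add: h_def word_poly_def right_diff_distrib)
  have "cosh_potential (2 / (v * real s)) (\<lambda>x. \<Sum>i\<leftarrow>w. F x - letter t i x) = cosh_potential (2 / v) h"
    unfolding cosh_potential_def sum_h using s0 by (simp add: field_simps)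
  with pot have pot': "cosh_potential (2 / v) h \<le> 2 * exp (36 * (real t)\<^sup>2 / (v\<^sup>2 * real s))"
    using s0 assms(5) by (simp add: field_simps power2_eq_square)
  have mh: "h \<in> borel_measurable borel" unfolding h_def[abs_def] F_def by measurable
  have hb: "cmod (h x) \<le> 3 * real t" for x
    using norm_triangle_ineq4[of "F x" "word_poly t w x"] Fb[of x] word_poly_bound[of t w x]
    unfolding h_def by linarith
  have "excess l h \<le> 4 * v\<^sup>2 * exp (- l / v) * cosh_potential (2 / v) h"
    by (rule excess_le_cosh_potential[OF mh hb]) (use assms in auto)
  also have "\<dots> \<le> 4 * v\<^sup>2 * exp (- l / v) * (2 * exp (36 * (real t)\<^sup>2 / (v\<^sup>2 * real s)))"
    by (intro mult_left_mono pot') auto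
  also have "\<dots> = 8 * v\<^sup>2 * exp (36 * (real t)\<^sup>2 / (v\<^sup>2 * real s) - l / v)"
    by (simp add: exp_diff exp_minus field_simps)
  finally show ?thesis
    using w unfolding h_def[abs_def] F_def I_def by blast
qed

text \<open>Where \<open>f\<close> is large, either \<open>k\<close> is at least half as large, or the error \<open>f - k\<close> is at least half of
  \<open>f\<close> and then well above the threshold \<open>l / 8\<close>.\<close>

lemma large_part_energy_split:
  assumes "0 < l"
  shows "(cmod (large_part l f x))\<^sup>2
    \<le> 4 * (cmod (large_part (l / 2) k x))\<^sup>2 + 8 * (max 0 (cmod (f x - k x) - l / 8))\<^sup>2"
proof (cases "l \<le> cmod (f x)")
  case False
  then show ?thesis by (simp add: large_part_def)
next
  case True
  show ?thesis
  proof (cases "cmod (f x) \<le> 2 * cmod (k x)")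
    case k: True
    then have "(cmod (f x))\<^sup>2 \<le> (2 * cmod (k x))\<^sup>2" by (intro power_mono) auto
    moreover have "l / 2 \<le> cmod (k x)" using k True by simp
    ultimately show ?thesis using True by (simp add: large_part_def power_mult_distrib add_increasing2)
  next
    case k: False
    define r where "r = max 0 (cmod (f x - k x) - l / 8)"
    have "cmod (f x) \<le> cmod (f x - k x) + cmod (k x)" by (metis diff_add_cancel norm_triangle_ineq)
    moreover have "cmod (f x - k x) - l / 8 \<le> r" by (simp add: r_def)
    ultimately have "3 * cmod (f x) \<le> 8 * r"
      using k True by linarith
    then have "(3 * cmod (f x))\<^sup>2 \<le> (8 * r)\<^sup>2" by (intro power_mono) auto
    then have "9 * (cmod (f x))\<^sup>2 \<le> 64 * r\<^sup>2" by (simp add: power_mult_distrib)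
    then have "(cmod (f x))\<^sup>2 \<le> 8 * r\<^sup>2" using zero_le_power2[of r] by linarith
    then show ?thesis using True by (simp add: large_part_def r_def[symmetric] add_increasing)
  qed
qed

text \<open>The error paired with the large part of \<open>k\<close> costs at most \<open>l / 8\<close> times that large part, hence a
  quarter of its square, and the excess over \<open>l / 8\<close> is absorbed by the inequality between
  arithmetic and geometric means.\<close>

lemma pairing_lower_bound:
  assumes "0 < l"
  shows "(cmod (large_part (l / 2) k x))\<^sup>2 / 2 - (max 0 (cmod (f x - k x) - l / 8))\<^sup>2
    \<le> Re (f x * cnj (large_part (l / 2) k x))"
proof (cases "l / 2 \<le> cmod (k x)")
  case False
  then show ?thesis by (simp add: large_part_def)
next
  case True
  define r where "r = max 0 (cmod (f x - k x) - l / 8)"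
  define u where "u = cmod (k x)"
  have "cmod (f x - k x) \<le> u / 4 + r" using True by (auto simp: r_def u_def max_def)
  then have "cmod (f x - k x) * u \<le> (u / 4 + r) * u" by (intro mult_right_mono) (auto simp: u_def)
  also have "\<dots> \<le> u\<^sup>2 / 2 + r\<^sup>2"
    using zero_le_power2[of "u / 2 - r"] by (simp add: power2_eq_square algebra_simps)
  finally have 1: "cmod (f x - k x) * u \<le> u\<^sup>2 / 2 + r\<^sup>2" .
  have "Re (f x * cnj (k x)) = u\<^sup>2 + Re ((f x - k x) * cnj (k x))"
    unfolding u_def cmod_power2 by (simp add: power2_eq_square algebra_simps)
  moreover have "\<bar>Re ((f x - k x) * cnj (k x))\<bar> \<le> cmod (f x - k x) * u"
    unfolding u_def by (metis abs_Re_le_cmod complex_mod_cnj norm_mult)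
  ultimately have "u\<^sup>2 / 2 - r\<^sup>2 \<le> Re (f x * cnj (k x))" using 1 by linarith
  then show ?thesis using True by (simp add: large_part_def u_def r_def)
qed

text \<open>Where \<open>f\<close> is below \<open>l / 32\<close> the product is at most a sixteenth of the square of the large part of
  \<open>k\<close>, which is at least \<open>l / 2\<close>. So a pairing that exceeds this by a fixed factor
  forces energy of \<open>f\<close> above \<open>l / 32\<close>.\<close>

lemma pairing_upper_bound:
  assumes "0 < l"
  shows "Re (f x * cnj (large_part (l / 2) k x))
    \<le> 8 * (cmod (large_part (l / 32) f x))\<^sup>2 + 3 / 32 * (cmod (large_part (l / 2) k x))\<^sup>2"
proof (cases "l / 2 \<le> cmod (k x)")
  case False
  then show ?thesis by (simp add: large_part_def)
next
  case True
  define u where "u = cmod (k x)"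
  define z where "z = cmod (f x)"
  have "Re (f x * cnj (k x)) \<le> z * u"
    unfolding u_def z_def by (metis complex_Re_le_cmod complex_mod_cnj norm_mult)
  also have "z * u \<le> 8 * (cmod (large_part (l / 32) f x))\<^sup>2 + 3 / 32 * u\<^sup>2"
  proof (cases "l / 32 \<le> z")
    case z: True
    have "z * u \<le> 8 * z\<^sup>2 + u\<^sup>2 / 32"
      using zero_le_power2[of "8 * z - u / 2"] by (simp add: power2_eq_square algebra_simps)
    also have "\<dots> \<le> 8 * z\<^sup>2 + 3 / 32 * u\<^sup>2" by simp
    finally show ?thesis using z by (simp add: large_part_def z_def)
  next
    case z: False
    have "z * u \<le> (u / 16) * u"
      using z True by (intro mult_right_mono) (auto simp: u_def)
    also have "\<dots> \<le> 3 / 32 * u\<^sup>2" by (simp add: power2_eq_square)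
    finally show ?thesis by (simp add: add_increasing)
  qed
  finally show ?thesis using True by (simp add: large_part_def u_def)
qed

text \<open>One round of the reduction. The hypothesis \<open>good\<close> concerns the large parts \<open>g\<close> of the sparse
  averages only, which form a finite family that depends on \<open>T\<close> through its cardinality and not on \<open>b\<close>. The set \<open>T'\<close> consists of the
  frequencies where the coefficient of \<open>g\<close> exceeds the truncation height \<open>energy g / (8 y)\<close>. There
  are at most \<open>y\<close> of them since each contributes the full height to a sum less than \<open>energy g / 8\<close>,
  and the remaining frequencies contribute to the pairing of the polynomial with \<open>g\<close> at most that
  same sum.\<close>

lemma sparsify:
  assumes S: "finite S" "T \<subseteq> S" "T \<noteq> {}" and b: "\<And>n. n \<in> T \<Longrightarrow> cmod (b n) \<le> 1"
    and pos: "1 \<le> s" "0 < y" "0 < v" "0 < l"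
  defines "t \<equiv> card T" and "A \<equiv> energy (large_part l (trig_poly T b))"
  assumes small: "256 * v\<^sup>2 * exp (36 * (real t)\<^sup>2 / (v\<^sup>2 * real s) - l / (8 * v)) \<le> A"
    and good: "\<And>w g. length w = s \<Longrightarrow> set w \<subseteq> S \<times> {..<4} \<Longrightarrow> g = large_part (l / 2) (word_poly t w) \<Longrightarrow>
        A / 8 \<le> energy g \<Longrightarrow>
        (\<Sum>n\<in>S. min (cmod (fourier_coeff g n)) (energy g / (8 * y))) < energy g / 8"
  shows "\<exists>T'\<subseteq>T. real (card T') \<le> y \<and> A / 2048 \<le> energy (large_part (l / 32) (trig_poly T' b))"
proof -
  have fT: "finite T" using S finite_subset by blast
  have "0 < 256 * v\<^sup>2 * exp (36 * (real t)\<^sup>2 / (v\<^sup>2 * real s) - l / (8 * v))"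
    using pos by simp
  then have A0: "0 < A" using small by linarith
  obtain w where w: "length w = s" "set w \<subseteq> T \<times> {..<4}"
    and ex: "excess (l / 8) (\<lambda>x. trig_poly T b x - word_poly t w x)
      \<le> 8 * v\<^sup>2 * exp (36 * (real t)\<^sup>2 / (v\<^sup>2 * real s) - l / 8 / v)"
    using word_approximation[where b=b and l="l / 8", OF fT S(3) b pos(1,3)] pos unfolding t_def by auto
  define f where "f = trig_poly T b"
  define k where "k = word_poly t w"
  define g where "g = large_part (l / 2) k"
  define G where "G = energy g"
  define E where "E = excess (l / 8) (\<lambda>x. f x - k x)"
  have [measurable]: "f \<in> borel_measurable borel" "k \<in> borel_measurable borel"
    unfolding f_def k_def by measurable
  have mg [measurable]: "g \<in> borel_measurable borel" unfolding g_def by measurable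
  have fb: "cmod (f x) \<le> real t" for x
    unfolding f_def t_def by (rule trig_poly_bound[OF b])
  have kb: "cmod (k x) \<le> 2 * real t" for x
    unfolding k_def by (rule word_poly_bound)
  have gb: "cmod (g x) \<le> 2 * real t" for x
    using kb[of x] large_part_bound[of "l / 2" k x] unfolding g_def by linarith
  have hb: "cmod (f x - k x) \<le> 3 * real t" for x
    using norm_triangle_ineq4[of "f x" "k x"] fb[of x] kb[of x] by linarith
  have lfb: "cmod (large_part l f x) \<le> real t" for x
    using fb[of x] large_part_bound[of l f x] by linarith
  have ig: "integrable unit_lebesgue (\<lambda>x. (cmod (g x))\<^sup>2)"
    by (rule integrable_energy[OF mg gb])
  have iE: "integrable unit_lebesgue (\<lambda>x. (max 0 (cmod (f x - k x) - l / 8))\<^sup>2)"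
    by (rule integrable_excess[OF _ hb]) (use pos in auto)
  have il: "integrable unit_lebesgue (\<lambda>x. (cmod (large_part l f x))\<^sup>2)"
    by (rule integrable_energy[OF _ lfb]) measurable
  have "32 * E \<le> 256 * v\<^sup>2 * exp (36 * (real t)\<^sup>2 / (v\<^sup>2 * real s) - l / (8 * v))"
    using ex unfolding E_def f_def k_def by simp
  then have E: "32 * E \<le> A" using small by linarith
  have "A \<le> (LINT x|unit_lebesgue. 4 * (cmod (g x))\<^sup>2 + 8 * (max 0 (cmod (f x - k x) - l / 8))\<^sup>2)"
    unfolding A_def energy_def f_def[symmetric]
    using il ig iE large_part_energy_split[OF pos(4), of f _ k]
    by (intro integral_mono) (auto simp: g_def)
  also have "\<dots> = 4 * G + 8 * E"
    using ig iE by (simp add: G_def E_def energy_def excess_def)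
  finally have AG: "A / 8 \<le> G" using E A0 by linarith
  then have EG: "4 * E \<le> G" using E by linarith
  have thin: "(\<Sum>n\<in>S. min (cmod (fourier_coeff g n)) (G / (8 * y))) < G / 8"
    unfolding G_def
  proof (rule good)
    show "length w = s" by fact
    show "set w \<subseteq> S \<times> {..<4}" using w S by auto
    show "g = large_part (l / 2) (word_poly t w)" by (simp add: g_def k_def)
    show "A / 8 \<le> energy g" using AG by (simp add: G_def)
  qed
  have ifg: "integrable unit_lebesgue (\<lambda>x. trig_poly U b x * cnj (g x))" if "U \<subseteq> T" for U
  proof (rule integrable_unit_bounded[where C="real (card U) * (2 * real t)"])
    fix x
    show "cmod (trig_poly U b x * cnj (g x)) \<le> real (card U) * (2 * real t)"
      using trig_poly_bound[of U b x] b that gb[of x] by (auto simp: norm_mult intro!: mult_mono)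
  qed measurable
  \<comment> \<open>The pairing of \<open>f\<close> with \<open>g\<close> is bounded from below pointwise, and evaluated through the Fourier coefficients of \<open>g\<close>.\<close>
  have "G / 4 \<le> G / 2 - E" using EG by linarith
  also have "\<dots> = (LINT x|unit_lebesgue. (cmod (g x))\<^sup>2 / 2 - (max 0 (cmod (f x - k x) - l / 8))\<^sup>2)"
    using ig iE by (simp add: G_def E_def energy_def excess_def)
  also have "\<dots> \<le> (LINT x|unit_lebesgue. Re (f x * cnj (g x)))"
    using ig iE ifg[of T] pairing_lower_bound[OF pos(4), of k _ f]
    by (intro integral_mono) (auto simp: g_def f_def simp del: times_complex.simps)
  also have "\<dots> = Re (LINT x|unit_lebesgue. f x * cnj (g x))"
    using ifg[of T] unfolding f_def by (intro integral_Re) auto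
  also have "\<dots> = Re (\<Sum>n\<in>T. b n * cnj (fourier_coeff g n))"
    unfolding f_def by (subst pairing_trig_poly[OF mg gb]) simp
  finally have low: "G / 4 \<le> Re (\<Sum>n\<in>T. b n * cnj (fourier_coeff g n))" .
  define T' where "T' = {n\<in>T. G / (8 * y) < cmod (fourier_coeff g n)}"
  have T': "T' \<subseteq> T" "finite T'" using fT by (auto simp: T'_def)
  have nonneg: "0 \<le> min (cmod (fourier_coeff g n)) (G / (8 * y))" for n
    using pos by (simp add: G_def)
  have "real (card T') * (G / (8 * y)) = (\<Sum>n\<in>T'. min (cmod (fourier_coeff g n)) (G / (8 * y)))"
    by (simp add: T'_def)
  also have "\<dots> \<le> (\<Sum>n\<in>S. min (cmod (fourier_coeff g n)) (G / (8 * y)))"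
    using S T' nonneg by (intro sum_mono2) auto
  also have "\<dots> < y * (G / (8 * y))" using thin pos by simp
  finally have "real (card T') * (G / (8 * y)) < y * (G / (8 * y))" .
  moreover have "0 < G / (8 * y)" using AG A0 pos by simp
  ultimately have card: "real (card T') \<le> y"
    using mult_less_cancel_right_pos less_imp_le by blast
  have "Re (\<Sum>n\<in>T - T'. b n * cnj (fourier_coeff g n)) \<le> (\<Sum>n\<in>T - T'. cmod (fourier_coeff g n))"
  proof -
    have "cmod (\<Sum>n\<in>T - T'. b n * cnj (fourier_coeff g n)) \<le> (\<Sum>n\<in>T - T'. cmod (fourier_coeff g n))"
      using b by (intro sum_norm_le) (auto simp: norm_mult mult_left_le_one_le)
    then show ?thesis using complex_Re_le_cmod order_trans by blast
  qed
  also have "\<dots> = (\<Sum>n\<in>T - T'. min (cmod (fourier_coeff g n)) (G / (8 * y)))"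
    by (intro sum.cong) (auto simp: T'_def)
  also have "\<dots> \<le> (\<Sum>n\<in>S. min (cmod (fourier_coeff g n)) (G / (8 * y)))"
    using S nonneg by (intro sum_mono2) auto
  finally have "Re (\<Sum>n\<in>T - T'. b n * cnj (fourier_coeff g n)) < G / 8" using thin by linarith
  then have "G / 8 \<le> Re (\<Sum>n\<in>T'. b n * cnj (fourier_coeff g n))"
    using low sum.subset_diff[OF T'(1) fT, of "\<lambda>n. b n * cnj (fourier_coeff g n)"] by simp
  also have "\<dots> = Re (LINT x|unit_lebesgue. trig_poly T' b x * cnj (g x))"
    by (subst pairing_trig_poly[OF mg gb]) simp
  also have "\<dots> = (LINT x|unit_lebesgue. Re (trig_poly T' b x * cnj (g x)))"
    using ifg[OF T'(1)] by (intro integral_Re[symmetric]) auto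
  also have "\<dots> \<le> (LINT x|unit_lebesgue. 8 * (cmod (large_part (l / 32) (trig_poly T' b) x))\<^sup>2
      + 3 / 32 * (cmod (g x))\<^sup>2)"
  proof (rule integral_mono)
    show "integrable unit_lebesgue (\<lambda>x. Re (trig_poly T' b x * cnj (g x)))"
      using ifg[OF T'(1)] by (rule integrable_Re)
    have "integrable unit_lebesgue (\<lambda>x. (cmod (large_part (l / 32) (trig_poly T' b) x))\<^sup>2)"
      by (rule integrable_energy[OF _ order_trans[OF large_part_bound trig_poly_bound']]) measurable
    then show "integrable unit_lebesgue (\<lambda>x. 8 * (cmod (large_part (l / 32) (trig_poly T' b) x))\<^sup>2
      + 3 / 32 * (cmod (g x))\<^sup>2)" using ig by simp
    show "Re (trig_poly T' b x * cnj (g x)) \<le> 8 * (cmod (large_part (l / 32) (trig_poly T' b) x))\<^sup>2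
      + 3 / 32 * (cmod (g x))\<^sup>2" for x
      unfolding g_def by (rule pairing_upper_bound[OF pos(4)])
  qed
  also have "\<dots> = 8 * energy (large_part (l / 32) (trig_poly T' b)) + 3 / 32 * G"
  proof -
    have "integrable unit_lebesgue (\<lambda>x. (cmod (large_part (l / 32) (trig_poly T' b) x))\<^sup>2)"
      by (rule integrable_energy[OF _ order_trans[OF large_part_bound trig_poly_bound']]) measurable
    then show ?thesis using ig by (simp add: G_def energy_def)
  qed
  finally have "A / 2048 \<le> energy (large_part (l / 32) (trig_poly T' b))"
    using AG by simp
  with card T' show ?thesis by blast
qed

section \<open>Concentration for the random set\<close>

lemma bernoulli_familyD:
  assumes "bernoulli_family \<tau> N M \<xi>"
  shows "prob_space M"
    and "prob_space.indep_vars M (\<lambda>_. count_space UNIV) \<xi> {1..N}"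
    and "n \<in> {1..N} \<Longrightarrow> \<omega> \<in> space M \<Longrightarrow> \<xi> n \<omega> = 0 \<or> \<xi> n \<omega> = 1"
    and "n \<in> {1..N} \<Longrightarrow> measure M {\<omega>\<in>space M. \<xi> n \<omega> = 1} = \<tau>"
    and "n \<in> {1..N} \<Longrightarrow> \<xi> n \<in> measurable M (count_space UNIV)"
  using assms unfolding bernoulli_family_def
  by (auto simp: prob_space.indep_vars_def)

lemma random_set_subset: "random_set N \<xi> \<omega> \<subseteq> {1..N}"
  by (auto simp: random_set_def)

text \<open>A property of the random set is a union of events that fix which of the finitely many variables
  are 1.\<close>

lemma sets_random_set:
  assumes "bernoulli_family \<tau> N M \<xi>"
  shows "{\<omega>\<in>space M. P (random_set N \<xi> \<omega>)} \<in> sets M"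
proof -
  have eq: "random_set N \<xi> \<omega> = S \<longleftrightarrow> (\<forall>n\<in>{1..N}. (\<xi> n \<omega> = 1) = (n \<in> S))"
    if "S \<subseteq> {1..N}" for S \<omega>
    using that unfolding random_set_def set_eq_iff by blast
  have meas: "{\<omega>\<in>space M. random_set N \<xi> \<omega> = S} \<in> sets M" if "S \<subseteq> {1..N}" for S
    unfolding eq[OF that]
  proof (rule sets.sets_Collect_finite_All)
    fix n assume "n \<in> {1..N}"
    note [measurable] = bernoulli_familyD(5)[OF assms this]
    show "{\<omega>\<in>space M. (\<xi> n \<omega> = 1) = (n \<in> S)} \<in> sets M" by measurable
  qed auto
  have "{\<omega>\<in>space M. P (random_set N \<xi> \<omega>)}
    = (\<Union>S\<in>{S. S \<subseteq> {1..N} \<and> P S}. {\<omega>\<in>space M. random_set N \<xi> \<omega> = S})"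
    using random_set_subset[of N \<xi>] by blast
  also have "\<dots> \<in> sets M"
    by (intro sets.finite_UN) (use meas in auto)
  finally show ?thesis .
qed

lemma expectation_exp_random_set:
  assumes bf: "bernoulli_family \<tau> N M \<xi>"
  shows "integrable M (\<lambda>\<omega>. exp (\<Sum>n\<in>random_set N \<xi> \<omega>. u n))"
    and "(LINT \<omega>|M. exp (\<Sum>n\<in>random_set N \<xi> \<omega>. u n)) = (\<Prod>n=1..N. 1 + \<tau> * (exp (u n) - 1))"
proof -
  interpret prob_space M by (rule bernoulli_familyD[OF bf])
  define X where "X n \<omega> = exp (u n * real (\<xi> n \<omega>))" for n \<omega>
  have ind: "indep_vars (\<lambda>_. borel) X {1..N}"
    unfolding X_def[abs_def]
    by (rule indep_vars_compose2[OF bernoulli_familyD(2)[OF bf]]) auto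
  have mX: "X n \<in> borel_measurable M" if "n \<in> {1..N}" for n
    using bernoulli_familyD(5)[OF bf that] unfolding X_def by measurable
  have X_eq: "X n \<omega> = 1 + (exp (u n) - 1) * indicator {\<omega>\<in>space M. \<xi> n \<omega> = 1} \<omega>"
    if "n \<in> {1..N}" "\<omega> \<in> space M" for n \<omega>
    using bernoulli_familyD(3)[OF bf that] that by (auto simp: X_def indicator_def)
  have ev: "{\<omega>\<in>space M. \<xi> n \<omega> = 1} \<in> sets M" if "n \<in> {1..N}" for n
    using bernoulli_familyD(5)[OF bf that] by measurable
  have intX: "integrable M (X n)" if "n \<in> {1..N}" for n
  proof -
    have "integrable M (indicator {\<omega>\<in>space M. \<xi> n \<omega> = 1} :: _ \<Rightarrow> real)"
      using ev[OF that] by (intro integrable_const_bound[where B=1]) auto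
    then have "integrable M (\<lambda>\<omega>. 1 + (exp (u n) - 1) * indicator {\<omega>\<in>space M. \<xi> n \<omega> = 1} \<omega>)"
      by (intro Bochner_Integration.integrable_add integrable_mult_right) auto
    then show ?thesis
      by (subst Bochner_Integration.integrable_cong[OF refl X_eq[OF that]]) auto
  qed
  have EX: "(LINT \<omega>|M. X n \<omega>) = 1 + \<tau> * (exp (u n) - 1)" if "n \<in> {1..N}" for n
  proof -
    have i: "integrable M (indicator {\<omega>\<in>space M. \<xi> n \<omega> = 1} :: _ \<Rightarrow> real)"
      using ev[OF that] by (intro integrable_const_bound[where B=1]) auto
    have "(LINT \<omega>|M. X n \<omega>)
        = (LINT \<omega>|M. 1 + (exp (u n) - 1) * indicator {\<omega>\<in>space M. \<xi> n \<omega> = 1} \<omega>)"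
      by (rule Bochner_Integration.integral_cong[OF refl X_eq[OF that]])
    also have "\<dots> = 1 + (exp (u n) - 1) * (LINT \<omega>|M. indicator {\<omega>\<in>space M. \<xi> n \<omega> = 1} \<omega>)"
      using i by (subst Bochner_Integration.integral_add) (auto simp: prob_space)
    also have "(LINT \<omega>|M. indicator {\<omega>\<in>space M. \<xi> n \<omega> = 1} \<omega>) = \<tau>"
      using ev[OF that] bernoulli_familyD(4)[OF bf that] by simp
    finally show ?thesis by simp
  qed
  have eq: "exp (\<Sum>n\<in>random_set N \<xi> \<omega>. u n) = (\<Prod>n=1..N. X n \<omega>)" if "\<omega> \<in> space M" for \<omega>
  proof -
    have "(\<Sum>n\<in>random_set N \<xi> \<omega>. u n) = (\<Sum>n=1..N. if \<xi> n \<omega> = 1 then u n else 0)"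
      unfolding random_set_def by (rule sum.inter_filter) simp
    also have "\<dots> = (\<Sum>n=1..N. u n * real (\<xi> n \<omega>))"
    proof (rule sum.cong[OF refl])
      fix n assume "n \<in> {1..N}"
      from bernoulli_familyD(3)[OF bf this that]
      show "(if \<xi> n \<omega> = 1 then u n else 0) = u n * real (\<xi> n \<omega>)" by auto
    qed
    finally show ?thesis by (simp add: exp_sum X_def)
  qed
  show "integrable M (\<lambda>\<omega>. exp (\<Sum>n\<in>random_set N \<xi> \<omega>. u n))"
    using indep_vars_integrable[OF _ ind intX]
    by (subst Bochner_Integration.integrable_cong[OF refl eq]) auto
  show "(LINT \<omega>|M. exp (\<Sum>n\<in>random_set N \<xi> \<omega>. u n)) = (\<Prod>n=1..N. 1 + \<tau> * (exp (u n) - 1))"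
    using indep_vars_lebesgue_integral[OF _ ind intX] EX
    by (subst Bochner_Integration.integral_cong[OF refl eq]) auto
qed

text \<open>Independence makes the exponential moment a product, and each of its factors is at most an
  exponential.\<close>

lemma exponential_markov:
  assumes bf: "bernoulli_family \<tau> N M \<xi>" and "0 \<le> \<tau>" "\<tau> \<le> 1"
  shows "measure M {\<omega>\<in>space M. y \<le> (\<Sum>n\<in>random_set N \<xi> \<omega>. u n)}
    \<le> exp (\<tau> * (\<Sum>n=1..N. exp (u n) - 1) - y)"
proof -
  interpret prob_space M by (rule bernoulli_familyD[OF bf])
  define A where "A = {\<omega>\<in>space M. y \<le> (\<Sum>n\<in>random_set N \<xi> \<omega>. u n)}"
  have A: "A \<in> sets M" unfolding A_def by (rule sets_random_set[OF bf])
  have "measure M A = (LINT \<omega>|M. indicator A \<omega>)" using A by simp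
  also have "\<dots> \<le> (LINT \<omega>|M. exp (- y) * exp (\<Sum>n\<in>random_set N \<xi> \<omega>. u n))"
  proof (rule integral_mono)
    show "integrable M (indicator A :: _ \<Rightarrow> real)"
      using A by (intro integrable_const_bound[where B=1]) auto
    show "integrable M (\<lambda>\<omega>. exp (- y) * exp (\<Sum>n\<in>random_set N \<xi> \<omega>. u n))"
      using expectation_exp_random_set(1)[OF bf] by simp
    fix \<omega>
    show "indicator A \<omega> \<le> exp (- y) * exp (\<Sum>n\<in>random_set N \<xi> \<omega>. u n)"
      by (auto simp: A_def indicator_def exp_minus field_simps)
  qed
  also have "\<dots> = exp (- y) * (\<Prod>n=1..N. 1 + \<tau> * (exp (u n) - 1))"
    using expectation_exp_random_set[OF bf] by simp
  also have "\<dots> \<le> exp (- y) * (\<Prod>n=1..N. exp (\<tau> * (exp (u n) - 1)))"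
  proof (intro mult_left_mono prod_mono conjI)
    fix n
    have "0 \<le> (1 - \<tau>) + \<tau> * exp (u n)" using assms by simp
    then show "0 \<le> 1 + \<tau> * (exp (u n) - 1)" by (simp add: algebra_simps)
    show "1 + \<tau> * (exp (u n) - 1) \<le> exp (\<tau> * (exp (u n) - 1))"
      by (rule exp_ge_add_one_self)
  qed auto
  also have "\<dots> = exp (\<tau> * (\<Sum>n=1..N. exp (u n) - 1) - y)"
    by (simp only: exp_sum[OF finite_atLeastAtMost, symmetric] exp_add[symmetric] sum_distrib_left)
      (simp add: algebra_simps)
  finally show ?thesis by (simp add: A_def)
qed

lemma exp_mult_le_chord:
  assumes "0 \<le> x" "x \<le> (1::real)"
  shows "exp (c * x) \<le> 1 + (exp c - 1) * x"
proof -
  have "exp ((1 - x) * 0 + x * c) \<le> (1 - x) * exp 0 + x * exp c"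
    using convex_onD[OF exp_convex, of x 0 c] assms by simp
  then show ?thesis by (simp add: algebra_simps)
qed

text \<open>The exponential moment with parameter \<open>- ln \<rho>\<close>, which is positive only for \<open>\<rho> < 1\<close>. For
  \<open>\<rho> \<ge> 1\<close> the bound exceeds 1.\<close>

lemma chernoff:
  assumes bf: "bernoulli_family \<tau> N M \<xi>" and "0 \<le> \<tau>" "\<tau> \<le> 1"
    and x: "\<And>n. n \<in> {1..N} \<Longrightarrow> 0 \<le> x n \<and> x n \<le> 1"
    and mean: "\<tau> * (\<Sum>n=1..N. x n) \<le> \<rho> * y" and "0 < \<rho>" "0 < y"
  shows "measure M {\<omega>\<in>space M. y \<le> (\<Sum>n\<in>random_set N \<xi> \<omega>. x n)} \<le> (exp 1 * \<rho>) powr y"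
proof (cases "\<rho> < 1")
  case False
  interpret prob_space M by (rule bernoulli_familyD[OF bf])
  have "1 * 1 \<le> exp 1 * \<rho>" using False by (intro mult_mono) auto
  then have "1 \<le> (exp 1 * \<rho>) powr y" using assms by (intro ge_one_powr_ge_zero) auto
  then show ?thesis using prob_le_1 order_trans by blast
next
  case True
  define c where "c = - ln \<rho>"
  have c: "0 < c" using True assms by (simp add: c_def)
  have ec: "exp c = 1 / \<rho>" using assms by (simp add: c_def exp_minus inverse_eq_divide)
  have "{\<omega>\<in>space M. y \<le> (\<Sum>n\<in>random_set N \<xi> \<omega>. x n)}
      = {\<omega>\<in>space M. c * y \<le> (\<Sum>n\<in>random_set N \<xi> \<omega>. c * x n)}"
    using c by (simp add: sum_distrib_left[symmetric])
  also have "measure M \<dots> \<le> exp (\<tau> * (\<Sum>n=1..N. exp (c * x n) - 1) - c * y)"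
    by (rule exponential_markov[OF assms(1-3)])
  also have "\<dots> \<le> exp (y - c * y)"
  proof -
    have "(\<Sum>n=1..N. exp (c * x n) - 1) \<le> (\<Sum>n=1..N. (exp c - 1) * x n)"
      using exp_mult_le_chord[of "x _" c] x by (intro sum_mono) (simp add: algebra_simps)
    also have "\<dots> = (exp c - 1) * (\<Sum>n=1..N. x n)" by (simp add: sum_distrib_left)
    finally have "\<tau> * (\<Sum>n=1..N. exp (c * x n) - 1) \<le> (exp c - 1) * (\<tau> * (\<Sum>n=1..N. x n))"
      using assms(2) by (simp add: mult.left_commute mult_left_mono)
    also have "\<dots> \<le> (exp c - 1) * (\<rho> * y)"
      using mean c by (intro mult_left_mono) auto
    also have "\<dots> \<le> y"
      using assms by (simp add: ec field_simps)
    finally show ?thesis by simp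
  qed
  also have "\<dots> = (exp 1 * \<rho>) powr y"
    using assms by (simp add: powr_def ln_mult c_def algebra_simps)
  finally show ?thesis .
qed

text \<open>By Bessel and Cauchy-Schwarz the full sum of the coefficients over \<open>{1..N}\<close> is at most
  \<open>\<surd>(N energy g)\<close>. The truncated coefficients, divided by the truncation height, lie between 0 and 1,
  and Chernoff's bound applies to them with threshold \<open>y\<close>.\<close>

lemma fourier_sum_exceeds_prob:
  assumes bf: "bernoulli_family \<tau> N M \<xi>" and "0 < \<tau>" "\<tau> \<le> 1" "1 \<le> N" "0 < y"
    and m [measurable]: "g \<in> borel_measurable borel" and g: "\<And>x. cmod (g x) \<le> C" and G0: "0 < energy g"
  shows "measure M {\<omega>\<in>space M. energy g / 8 \<le>
      (\<Sum>n\<in>random_set N \<xi> \<omega>. min (cmod (fourier_coeff g n)) (energy g / (8 * y)))}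
    \<le> (exp 1 * (8 * (\<tau> * N) / sqrt (N * energy g))) powr y"
proof -
  define G where "G = energy g"
  define x where "x n = min (cmod (fourier_coeff g n)) (G / (8 * y)) / (G / (8 * y))" for n
  have G: "0 < G" using G0 by (simp add: G_def)
  have "(\<Sum>n=1..N. cmod (fourier_coeff g n)) \<le> sqrt (N * G)"
  proof (rule real_le_rsqrt)
    have "(\<Sum>n=1..N. 1 * cmod (fourier_coeff g n))\<^sup>2
      \<le> (\<Sum>n=1..N. 1\<^sup>2) * (\<Sum>n=1..N. (cmod (fourier_coeff g n))\<^sup>2)"
      by (rule Cauchy_Schwarz_ineq_sum)
    also have "\<dots> \<le> N * G"
      using bessel[OF m g, of "{1..N}"] by (simp add: G_def mult_left_mono)
    finally show "(\<Sum>n=1..N. cmod (fourier_coeff g n))\<^sup>2 \<le> N * G" by simp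
  qed
  moreover have "(\<Sum>n=1..N. x n) \<le> (\<Sum>n=1..N. cmod (fourier_coeff g n) / (G / (8 * y)))"
    unfolding x_def using G assms by (intro sum_mono divide_right_mono) auto
  moreover have "(\<Sum>n=1..N. cmod (fourier_coeff g n) / (G / (8 * y)))
      = (\<Sum>n=1..N. cmod (fourier_coeff g n)) / (G / (8 * y))"
    by (simp only: sum_divide_distrib)
  moreover have "0 \<le> G / (8 * y)" using G assms by simp
  ultimately have "(\<Sum>n=1..N. x n) \<le> sqrt (N * G) / (G / (8 * y))"
    using divide_right_mono order_trans by metis
  also have "sqrt (N * G) / (G / (8 * y)) = 8 * N / sqrt (N * G) * y"
    using G assms real_sqrt_mult_self[of "N * G"] by (simp add: field_simps)
  finally have "\<tau> * (\<Sum>n=1..N. x n) \<le> \<tau> * (8 * N / sqrt (N * G) * y)"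
    using assms by (intro mult_left_mono) auto
  then have mean: "\<tau> * (\<Sum>n=1..N. x n) \<le> (8 * (\<tau> * N) / sqrt (N * G)) * y"
    by (simp add: mult_ac)
  have "{\<omega>\<in>space M. G / 8 \<le> (\<Sum>n\<in>random_set N \<xi> \<omega>. min (cmod (fourier_coeff g n)) (G / (8 * y)))}
    = {\<omega>\<in>space M. y \<le> (\<Sum>n\<in>random_set N \<xi> \<omega>. x n)}"
    unfolding x_def sum_divide_distrib[symmetric] using G assms by (simp add: pos_le_divide_eq)
  also have "measure M \<dots> \<le> (exp 1 * (8 * (\<tau> * N) / sqrt (N * G))) powr y"
  proof (rule chernoff[OF bf _ _ _ mean])
    have c: "0 < G / (8 * y)" using G assms by simp
    show "0 \<le> x n \<and> x n \<le> 1" for n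
      unfolding x_def divide_le_eq_1_pos[OF c] using c by (intro conjI divide_nonneg_pos) auto
  qed (use assms G in auto)
  finally show ?thesis by (simp add: G_def)
qed

text \<open>The property of a set that is needed for one round of the reduction, for all averages of \<open>s\<close> letters
  whose large part has energy at least \<open>Q / N\<close>.\<close>

definition word_uniform :: "nat \<Rightarrow> real \<Rightarrow> real \<Rightarrow> real \<Rightarrow> nat \<Rightarrow> nat \<Rightarrow> nat set \<Rightarrow> bool" where
  "word_uniform N Q l y s t S \<longleftrightarrow>
    (\<forall>w g. length w = s \<longrightarrow> set w \<subseteq> {1..N} \<times> {..<4} \<longrightarrow> g = large_part l (word_poly t w) \<longrightarrow>
      Q \<le> N * energy g \<longrightarrow>
      (\<Sum>n\<in>S. min (cmod (fourier_coeff g n)) (energy g / (8 * y))) < energy g / 8)"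

text \<open>With energies at least \<open>energy_floor R N B / N\<close>, the base of Chernoff's bound is at most
  \<open>N\<^bsup>-8/B\<^esup>\<close>. Its power with exponent \<open>y = B s\<close> is then \<open>N\<^bsup>-8s\<^esup>\<close>, which beats the number
  \<open>(4 N)\<^sup>s\<close> of words. The price is the factor \<open>N\<^bsup>16/B\<^esup>\<close>.\<close>

definition energy_floor :: "real \<Rightarrow> nat \<Rightarrow> real \<Rightarrow> real" where
  "energy_floor R N B = (8 * exp 1 * R)\<^sup>2 * real N powr (16 / B)"

lemma word_uniform_fails_prob:
  assumes bf: "bernoulli_family \<tau> N M \<xi>" and \<tau>: "0 < \<tau>" "\<tau> \<le> 1" and "2 \<le> N" "0 < B" "1 \<le> s"
  shows "measure M {\<omega>\<in>space M.
      \<not> word_uniform N (energy_floor (\<tau> * N) N B) l (B * s) s t (random_set N \<xi> \<omega>)} \<le> real N powr (- 5)"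
proof -
  interpret prob_space M by (rule bernoulli_familyD[OF bf])
  define W where "W = {w. set w \<subseteq> {1..N} \<times> {..<4::nat} \<and> length w = s}"
  define g where "g w = large_part l (word_poly t w)" for w
  define Q where "Q = energy_floor (\<tau> * N) N B"
  define Bad where "Bad w = {\<omega>\<in>space M. Q \<le> N * energy (g w) \<and> energy (g w) / 8 \<le>
      (\<Sum>n\<in>random_set N \<xi> \<omega>. min (cmod (fourier_coeff (g w) n)) (energy (g w) / (8 * (B * s))))}" for w
  have y: "0 < B * real s" using assms by simp
  have N: "0 < real N" using assms by simp
  have Q: "0 < Q" using N \<tau> by (simp add: Q_def energy_floor_def)
  have finW: "finite W" unfolding W_def by (rule finite_lists_length_eq) auto
  have cardW: "card W = (N * 4) ^ s"
    unfolding W_def by (subst card_lists_length_eq) (auto simp: card_cartesian_product)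
  have bad: "measure M (Bad w) \<le> real N powr (- (8 * real s))" for w
  proof (cases "Q \<le> N * energy (g w)")
    case False
    then show ?thesis by (simp add: Bad_def)
  next
    case True
    have mg: "g w \<in> borel_measurable borel" unfolding g_def by measurable
    have gb: "cmod (g w x) \<le> 2 * real t" for x
      using word_poly_bound[of t w x] large_part_bound[of l "word_poly t w" x] unfolding g_def by linarith
    have G: "0 < energy (g w)"
      using True Q N by (intro zero_less_mult_pos[of "real N" "energy (g w)"]) auto
    have "sqrt Q = 8 * exp 1 * (\<tau> * N) * real N powr (8 / B)"
      unfolding Q_def energy_floor_def using \<tau> N
      by (simp add: real_sqrt_mult powr_half_sqrt[symmetric] powr_powr)
    then have "8 * exp 1 * (\<tau> * N) * real N powr (8 / B) \<le> sqrt (N * energy (g w))"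
      using True by (metis real_sqrt_le_iff)
    then have le: "exp 1 * (8 * (\<tau> * N) / sqrt (N * energy (g w))) \<le> real N powr (- (8 / B))"
      using G N by (simp add: powr_minus field_simps)
    have "measure M (Bad w) \<le> (exp 1 * (8 * (\<tau> * N) / sqrt (N * energy (g w)))) powr (B * s)"
      using True fourier_sum_exceeds_prob[OF bf \<tau> _ y mg gb G] assms by (simp add: Bad_def)
    also have "\<dots> \<le> (real N powr (- (8 / B))) powr (B * s)"
      using le y \<tau> G N by (intro powr_mono2) auto
    also have "\<dots> = real N powr (- (8 * real s))"
      using assms by (simp add: powr_powr)
    finally show ?thesis .
  qed
  have "{\<omega>\<in>space M. \<not> word_uniform N Q l (B * s) s t (random_set N \<xi> \<omega>)} = (\<Union>w\<in>W. Bad w)"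
    unfolding word_uniform_def W_def Bad_def g_def by (auto simp: not_less)
  also have "measure M \<dots> \<le> (\<Sum>w\<in>W. measure M (Bad w))"
    unfolding Bad_def using sets_random_set[OF bf]
    by (intro finite_measure_subadditive_finite finW) auto
  also have "\<dots> \<le> (\<Sum>w\<in>W. real N powr (- (8 * real s)))"
    by (rule sum_mono[OF bad])
  also have "\<dots> = (real N * 4) ^ s * real N powr (- (8 * real s))"
    by (simp add: cardW)
  also have "\<dots> \<le> (real N ^ 3) ^ s * real N powr (- (8 * real s))"
  proof (intro mult_right_mono power_mono)
    have "(4::real) \<le> N ^ 2" using power_mono[of 2 "real N" 2] assms by simp
    then show "real N * 4 \<le> real N ^ 3" using N by (simp add: power2_eq_square power3_eq_cube)
  qed auto
  also have "\<dots> = real N powr (- (5 * real s))"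
  proof -
    have "(real N ^ 3) ^ s = real N powr (3 * real s)"
      using N powr_realpow[of "real N" "3 * s"] by (simp add: power_mult)
    moreover have "real N powr (3 * real s) * real N powr (- (8 * real s)) = real N powr (3 * real s + - (8 * real s))"
      by (rule powr_add[symmetric])
    ultimately show ?thesis by simp
  qed
  also have "\<dots> \<le> real N powr (- 5)"
    using assms by (intro powr_mono) auto
  finally show ?thesis by (simp add: Q_def)
qed

text \<open>Both bounds are the exponential moment inequality with all parameters 1, respectively -1.\<close>

lemma card_random_set_prob:
  fixes \<tau> :: real
  assumes bf: "bernoulli_family \<tau> N M \<xi>" and \<tau>: "0 \<le> \<tau>" "\<tau> \<le> 1"
  shows "measure M {\<omega>\<in>space M. 4 * (\<tau> * N) \<le> card (random_set N \<xi> \<omega>)} \<le> exp (- (\<tau> * N))"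
    and "measure M {\<omega>\<in>space M. card (random_set N \<xi> \<omega>) \<le> \<tau> * N / 4} \<le> exp (- (\<tau> * N) / 4)"
proof -
  have "measure M {\<omega>\<in>space M. 4 * (\<tau> * N) \<le> (\<Sum>n\<in>random_set N \<xi> \<omega>. 1)}
      \<le> exp (\<tau> * (\<Sum>n=1..N. exp 1 - 1) - 4 * (\<tau> * N))"
    by (rule exponential_markov[OF assms])
  also have "\<dots> \<le> exp (- (\<tau> * N))"
  proof -
    have "exp 1 \<le> (4 :: real)" using exp_le by simp
    then have "\<tau> * N * exp 1 \<le> \<tau> * N * 4" using \<tau> by (intro mult_left_mono) auto
    then show ?thesis by (simp add: algebra_simps)
  qed
  finally show "measure M {\<omega>\<in>space M. 4 * (\<tau> * N) \<le> card (random_set N \<xi> \<omega>)} \<le> exp (- (\<tau> * N))"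
    by simp
  have "measure M {\<omega>\<in>space M. - (\<tau> * N / 4) \<le> (\<Sum>n\<in>random_set N \<xi> \<omega>. - 1)}
      \<le> exp (\<tau> * (\<Sum>n=1..N. exp (- 1) - 1) - (- (\<tau> * N / 4)))"
    by (rule exponential_markov[OF assms])
  also have "\<dots> \<le> exp (- (\<tau> * N) / 4)"
  proof -
    have "(2::real) \<le> exp 1" using exp_ge_add_one_self[of 1] by simp
    then have "exp (- 1) \<le> (1 / 2 :: real)" by (simp add: exp_minus field_simps)
    then have "\<tau> * N * exp (- 1) \<le> \<tau> * N * (1 / 2)" using \<tau> by (intro mult_left_mono) auto
    then show ?thesis by (simp add: algebra_simps)
  qed
  finally show "measure M {\<omega>\<in>space M. card (random_set N \<xi> \<omega>) \<le> \<tau> * N / 4} \<le> exp (- (\<tau> * N) / 4)"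
    by simp
qed

section \<open>Decay of the energy at high levels\<close>

definition sample_length :: "real \<Rightarrow> real \<Rightarrow> nat \<Rightarrow> nat" where
  "sample_length B lam t = nat \<lceil>B * (real t / lam)\<^sup>2\<rceil>"

lemma sample_length_bounds:
  assumes "1 \<le> B * (real t / lam)\<^sup>2"
  shows "1 \<le> sample_length B lam t" "B * (real t / lam)\<^sup>2 \<le> sample_length B lam t"
    "sample_length B lam t \<le> 2 * (B * (real t / lam)\<^sup>2)"
  using assms unfolding sample_length_def by linarith+

lemma energy_large_part_eq_0:
  assumes "\<And>x. cmod (f x) < l"
  shows "energy (large_part l f) = 0"
  using assms by (simp add: energy_def large_part_def not_le[symmetric])

text \<open>The scale \<open>v\<close> is chosen so that the positive term of the exponent is half of the negative one at the
  lowest level \<open>lam / 32\<^sup>J\<close>. What remains is exponentially small in \<open>B\<close>.\<close>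

lemma approximation_error_small:
  fixes B lam :: real and J j D s t :: nat
  assumes "0 < lam" "1 \<le> B" "j \<le> J" "B * (real t / lam)\<^sup>2 \<le> s" "0 < t"
    and ex: "256 * (576 * 32 ^ J)\<^sup>2 * 2048 ^ J * B ^ D * exp (- B / (9216 * 1024 ^ J)) \<le> 1"
  defines "v \<equiv> 576 * 32 ^ J / B * lam"
  shows "256 * v\<^sup>2 * exp (36 * (real t)\<^sup>2 / (v\<^sup>2 * real s) - lam / 32 ^ j / (8 * v)) \<le> lam\<^sup>2 / B ^ D / 2048 ^ J"
proof -
  have v: "0 < v" using assms by (simp add: v_def)
  have s: "0 < real s"
  proof -
    have "0 < B * (real t / lam)\<^sup>2" using assms by simp
    then show ?thesis using assms(4) by linarith
  qed
  have v2: "v\<^sup>2 = (576 * 32 ^ J)\<^sup>2 * lam\<^sup>2 / B\<^sup>2" by (simp add: v_def power_mult_distrib power_divide)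
  have sq32: "(32 ^ J)\<^sup>2 = (1024 ^ J :: real)" by (simp add: power2_eq_square flip: power_mult_distrib)
  have "B * (real t)\<^sup>2 \<le> real s * lam\<^sup>2" using assms(1,4) by (simp add: power_divide divide_le_eq)
  then have "36 * (real t)\<^sup>2 / (v\<^sup>2 * real s) \<le> 36 * (real s * lam\<^sup>2 / B) / (v\<^sup>2 * real s)"
    using s assms(2) by (intro divide_right_mono mult_left_mono) (auto simp: field_simps)
  also have "\<dots> = B / (9216 * 1024 ^ J)"
    unfolding v2 power_mult_distrib sq32 using s assms(1,2) by (simp add: field_simps power2_eq_square)
  finally have e1: "36 * (real t)\<^sup>2 / (v\<^sup>2 * real s) \<le> B / (9216 * 1024 ^ J)" .
  have "(32::real) ^ j \<le> 32 ^ J" using assms(3) by (intro power_increasing) auto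
  then have "lam / 32 ^ J / (8 * v) \<le> lam / 32 ^ j / (8 * v)"
    using v assms(1) by (intro divide_right_mono divide_left_mono) auto
  moreover have "lam / 32 ^ J / (8 * v) = 2 * (B / (9216 * 1024 ^ J))"
    using assms(1,2) sq32 by (simp add: v_def power2_eq_square field_simps)
  ultimately have "36 * (real t)\<^sup>2 / (v\<^sup>2 * real s) - lam / 32 ^ j / (8 * v) \<le> - B / (9216 * 1024 ^ J)"
    using e1 by simp
  then have "256 * v\<^sup>2 * exp (36 * (real t)\<^sup>2 / (v\<^sup>2 * real s) - lam / 32 ^ j / (8 * v))
      \<le> 256 * v\<^sup>2 * exp (- B / (9216 * 1024 ^ J))"
    by (intro mult_left_mono) auto
  also have "\<dots> \<le> 256 * ((576 * 32 ^ J)\<^sup>2 * lam\<^sup>2) * exp (- B / (9216 * 1024 ^ J))"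
  proof -
    have "(576 * 32 ^ J)\<^sup>2 * lam\<^sup>2 / B\<^sup>2 \<le> (576 * 32 ^ J)\<^sup>2 * lam\<^sup>2 / 1"
      using assms(2) by (intro divide_left_mono) auto
    then show ?thesis unfolding v2 by (intro mult_right_mono mult_left_mono) auto
  qed
  also have "\<dots> = lam\<^sup>2 / B ^ D / 2048 ^ J *
      (256 * (576 * 32 ^ J)\<^sup>2 * 2048 ^ J * B ^ D * exp (- B / (9216 * 1024 ^ J)))"
    using assms(2) by (simp add: field_simps)
  also have "\<dots> \<le> lam\<^sup>2 / B ^ D / 2048 ^ J * 1"
    using ex assms(2) by (intro mult_left_mono) auto
  finally show ?thesis by simp
qed

text \<open>If both alternatives fail, then \<open>J\<close> rounds of the reduction are possible. Each round lowers the level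
  by the factor 32 and the energy by at most the factor 2048, and replaces a set of \<open>t\<close> frequencies
  by one of at most \<open>2 B\<^sup>2 (t / lam)\<^sup>2\<close>. The cardinality is at most \<open>lam\<^sup>2 / B\<^bsup>8+4j\<^esup>\<close> after \<open>j\<close>
  rounds, and at the end Parseval bounds the energy by the cardinality. The number of letters is
  computed with \<open>lam\<close> and not with the current level, so that the recursion for the cardinality is
  free of the factors 32.\<close>

lemma energy_large_part_bound:
  fixes B R lam Q :: real and J D N :: nat
  assumes S: "S \<subseteq> {1..N}" "card S \<le> 4 * R" and b: "\<And>n. n \<in> S \<Longrightarrow> cmod (b n) \<le> 1"
    and R: "0 < R" and lam: "lam = B ^ 8 * sqrt R" and Q: "0 < Q"
    and B: "2 \<le> B" "2048 ^ J \<le> B"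
    and ex: "256 * (576 * 32 ^ J)\<^sup>2 * 2048 ^ J * B ^ (4 * J) * exp (- B / (9216 * 1024 ^ J)) \<le> 1"
    and uniform: "\<And>j t. j < J \<Longrightarrow> t \<in> {1..N} \<Longrightarrow>
      word_uniform N Q (lam / 32 ^ j / 2) (B * sample_length B lam t) (sample_length B lam t) t S"
  shows "energy (large_part lam (trig_poly S b)) \<le> lam\<^sup>2 / B ^ (4 * J)
    \<or> N * energy (large_part lam (trig_poly S b)) \<le> 2048 ^ J * 8 * Q"
proof (rule ccontr)
  define A where "A = energy (large_part lam (trig_poly S b))"
  assume "\<not> ?thesis"
  then have A: "lam\<^sup>2 / B ^ (4 * J) < A" and NA: "2048 ^ J * 8 * Q < N * A"
    by (auto simp: A_def)
  have fS: "finite S" using S finite_subset by blast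
  have lam0: "0 < lam" using lam B R by simp
  have lam2: "lam\<^sup>2 = B ^ 16 * R" using R by (simp add: lam power_mult_distrib flip: power_mult)
  have A0: "0 < A"
    using A lam0 B by (meson divide_nonneg_nonneg le_less_trans zero_le_power zero_le_power2 order_trans zero_le_numeral)
  have "\<exists>T\<subseteq>S. real (card T) \<le> lam\<^sup>2 / B ^ (8 + 4 * j) \<and>
      A / 2048 ^ j \<le> energy (large_part (lam / 32 ^ j) (trig_poly T b))" if "j \<le> J" for j
    using that
  proof (induction j)
    case 0
    have "4 \<le> B ^ 8" using power_mono[of 2 B 8] B by simp
    then have "4 * R \<le> B ^ 8 * R" using R by (intro mult_right_mono) auto
    also have "\<dots> = lam\<^sup>2 / B ^ 8"
      using B by (simp add: lam2 eq_divide_eq mult.left_commute)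
    finally show ?case using S by (intro exI[of _ S]) (auto simp: A_def)
  next
    case (Suc j)
    then obtain T where T: "T \<subseteq> S" "real (card T) \<le> lam\<^sup>2 / B ^ (8 + 4 * j)"
      and AT: "A / 2048 ^ j \<le> energy (large_part (lam / 32 ^ j) (trig_poly T b))" by auto
    define t where "t = card T"
    define s where "s = sample_length B lam t"
    define l where "l = lam / 32 ^ j"
    define AT where "AT = energy (large_part l (trig_poly T b))"
    have l0: "0 < l" using lam0 by (simp add: l_def)
    have AjT: "A / 2048 ^ j \<le> AT" using AT by (simp add: AT_def l_def)
    have AT0: "0 < AT" using AjT A0 by (smt (verit) divide_pos_pos zero_less_power)
    \<comment> \<open>A polynomial with fewer than \<open>l\<close> frequencies never reaches the level \<open>l\<close>. Hence the argument of the ceiling in the number of letters is at least 1, and rounding at most doubles it.\<close>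
    have tl: "l \<le> t"
    proof (rule ccontr)
      assume "\<not> l \<le> t"
      then have "cmod (trig_poly T b x) < l" for x
        using trig_poly_bound[of T b x] b T by (force simp: t_def)
      from energy_large_part_eq_0[OF this] AT0 show False by (simp add: AT_def)
    qed
    have t0: "0 < t" using tl l0 by simp
    then have Tne: "T \<noteq> {}" by (auto simp: t_def)
    have tN: "t \<in> {1..N}"
      using t0 card_mono[of "{1..N}" T] T S by (auto simp: t_def)
    have "(2048::real) ^ j \<le> 2048 ^ J"
      using Suc.prems by (intro power_increasing) auto
    moreover have "(1024::real) ^ j \<le> 2048 ^ j" by (intro power_mono) auto
    ultimately have pow: "(2048::real) ^ j \<le> 2048 ^ J" "(1024::real) ^ j \<le> 2048 ^ J"
      by linarith+
    have "1 \<le> B / 1024 ^ j" using pow(2) B by simp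
    also have "B / 1024 ^ j = B * (1 / 32 ^ j)\<^sup>2"
      by (simp add: power2_eq_square flip: power_mult_distrib)
    also have "\<dots> \<le> B * (real t / lam)\<^sup>2"
      using tl lam0 B by (intro mult_left_mono power_mono) (auto simp: l_def field_simps)
    finally have s1: "1 \<le> B * (real t / lam)\<^sup>2" .
    note s = sample_length_bounds[OF s1, folded s_def]
    define v where "v = 576 * 32 ^ J / B * lam"
    have v0: "0 < v" using lam0 B by (simp add: v_def)
    have y0: "0 < B * real s" using s B by simp
    have "256 * v\<^sup>2 * exp (36 * (real t)\<^sup>2 / (v\<^sup>2 * real s) - lam / 32 ^ j / (8 * v))
        \<le> lam\<^sup>2 / B ^ (4 * J) / 2048 ^ J"
      unfolding v_def using lam0 B Suc.prems s t0 ex by (intro approximation_error_small) auto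
    also have "\<dots> \<le> A / 2048 ^ J" using A by (intro divide_right_mono) auto
    also have "\<dots> \<le> A / 2048 ^ j" using pow A0 by (intro divide_left_mono) auto
    also have "\<dots> \<le> AT" by (rule AjT)
    finally have small: "256 * v\<^sup>2 * exp (36 * (real t)\<^sup>2 / (v\<^sup>2 * real s) - l / (8 * v)) \<le> AT"
      by (simp add: l_def)
    have "\<exists>T'\<subseteq>T. real (card T') \<le> B * real s \<and>
        energy (large_part l (trig_poly T b)) / 2048 \<le> energy (large_part (l / 32) (trig_poly T' b))"
    proof (rule sparsify[OF fS T(1) Tne _ s(1) y0 v0 l0])
      show "cmod (b n) \<le> 1" if "n \<in> T" for n using b T that by blast
      show "256 * v\<^sup>2 * exp (36 * (real (card T))\<^sup>2 / (v\<^sup>2 * real s) - l / (8 * v))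
          \<le> energy (large_part l (trig_poly T b))"
        using small by (simp add: t_def AT_def)
    next
      fix w g
      assume w: "length w = s" "set w \<subseteq> S \<times> {..<4::nat}"
        and g: "g = large_part (l / 2) (word_poly (card T) w)"
        and Eg: "energy (large_part l (trig_poly T b)) / 8 \<le> energy g"
      have "2048 ^ J * 8 * Q \<le> N * A" using NA by simp
      also have "N * A \<le> N * (2048 ^ j * AT)"
        using AjT by (intro mult_left_mono) (auto simp: field_simps)
      also have "\<dots> \<le> N * (2048 ^ J * (8 * energy g))"
        using Eg pow AT0 by (intro mult_left_mono mult_mono) (auto simp: AT_def)
      finally have "Q \<le> N * energy g" by simp
      then show "(\<Sum>n\<in>S. min (cmod (fourier_coeff g n)) (energy g / (8 * (B * real s)))) < energy g / 8"
        using uniform[of j t] Suc.prems tN w g S unfolding word_uniform_def s_def t_def l_def by fastforce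
    qed
    then obtain T' where T': "T' \<subseteq> T" "real (card T') \<le> B * real s"
      "AT / 2048 \<le> energy (large_part (l / 32) (trig_poly T' b))"
      by (auto simp: AT_def)
    have "B * real s \<le> 2 * B\<^sup>2 * (real t)\<^sup>2 / lam\<^sup>2"
      using mult_left_mono[OF s(3), of B] B by (simp add: power2_eq_square mult_ac)
    also have "\<dots> \<le> 2 * B\<^sup>2 * (lam\<^sup>2 / B ^ (8 + 4 * j))\<^sup>2 / lam\<^sup>2"
      using T by (intro divide_right_mono mult_left_mono power_mono) (auto simp: t_def)
    also have "\<dots> = lam\<^sup>2 * (2 * B\<^sup>2 / (B ^ (8 + 4 * j) * B ^ (8 + 4 * j)))"
      using lam0 by (simp add: power2_eq_square)
    also have "\<dots> \<le> lam\<^sup>2 * (1 / B ^ (8 + 4 * Suc j))"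
    proof (rule mult_left_mono)
      have "2 * B\<^sup>2 * B ^ (8 + 4 * Suc j) \<le> B * B\<^sup>2 * B ^ (8 + 4 * Suc j)"
        using B by (intro mult_right_mono) auto
      also have "\<dots> = B ^ (3 + (8 + 4 * Suc j))"
          unfolding power_add[of B 3] power2_eq_square power3_eq_cube by (simp only: mult.assoc)
      also have "\<dots> \<le> B ^ ((8 + 4 * j) + (8 + 4 * j))"
        using B by (intro power_increasing) auto
      finally have "2 * B\<^sup>2 * B ^ (8 + 4 * Suc j) \<le> B ^ (8 + 4 * j) * B ^ (8 + 4 * j)"
        by (simp only: power_add)
      then show "2 * B\<^sup>2 / (B ^ (8 + 4 * j) * B ^ (8 + 4 * j)) \<le> 1 / B ^ (8 + 4 * Suc j)"
        using B by (intro frac_le_eq[THEN iffD2]) (auto simp: divide_simps)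
    qed auto
    finally have "real (card T') \<le> lam\<^sup>2 / B ^ (8 + 4 * Suc j)" using T'(2) by simp
    moreover have "A / 2048 ^ Suc j \<le> energy (large_part (lam / 32 ^ Suc j) (trig_poly T' b))"
    proof -
      have "A / 2048 ^ Suc j \<le> AT / 2048" using AjT by (simp add: field_simps)
      moreover have "l / 32 = lam / 32 ^ Suc j" by (simp add: l_def)
      ultimately show ?thesis using T'(3) by (metis order_trans)
    qed
    moreover have "T' \<subseteq> S" using T'(1) T(1) by blast
    ultimately show ?case by blast
  qed
  from this[of J] obtain T where T: "T \<subseteq> S" "real (card T) \<le> lam\<^sup>2 / B ^ (8 + 4 * J)"
    "A / 2048 ^ J \<le> energy (large_part (lam / 32 ^ J) (trig_poly T b))" by auto
  have fT: "finite T" using T fS finite_subset by blast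
  have "A / 2048 ^ J \<le> energy (large_part (lam / 32 ^ J) (trig_poly T b))" by fact
  also have "\<dots> \<le> energy (trig_poly T b)"
    unfolding energy_def
    by (intro integral_mono integrable_energy[OF _ trig_poly_bound']
        integrable_energy[OF _ order_trans[OF large_part_bound trig_poly_bound']] power_mono large_part_bound)
      auto
  also have "\<dots> = (\<Sum>n\<in>T. (cmod (b n))\<^sup>2)" by (rule energy_trig_poly[OF fT])
  also have "\<dots> \<le> (\<Sum>n\<in>T. 1)"
    using b T by (intro sum_mono) (auto simp: power_le_one)
  also have "\<dots> \<le> lam\<^sup>2 / B ^ (8 + 4 * J)" using T by simp
  finally have "A \<le> 2048 ^ J * (lam\<^sup>2 / B ^ (8 + 4 * J))" by (simp add: field_simps)
  also have "\<dots> \<le> B ^ 8 * (lam\<^sup>2 / B ^ (8 + 4 * J))"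
  proof (rule mult_right_mono)
    have "B \<le> B ^ 8" using power_increasing[of 1 8 B] B by simp
    then show "2048 ^ J \<le> B ^ 8" using B by linarith
  qed (use B in auto)
  also have "\<dots> = lam\<^sup>2 / B ^ (4 * J)" using B by (simp add: power_add)
  finally show False using A by simp
qed

lemma power2_sandwich:
  assumes "1 \<le> (x::real)"
  shows "\<exists>n. x \<le> 2 ^ n \<and> 2 ^ n \<le> 2 * x"
proof -
  obtain k where k: "x \<le> 2 ^ k" using real_arch_pow[of 2 x] by (auto intro: less_imp_le)
  define n where "n = (LEAST n. x \<le> 2 ^ n)"
  have n: "x \<le> 2 ^ n" unfolding n_def using k by (rule LeastI)
  have "2 ^ n \<le> 2 * x"
  proof (cases n)
    case 0
    then show ?thesis using assms by simp
  next
    case (Suc m)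
    then have "\<not> x \<le> 2 ^ m" using not_less_Least[of m "\<lambda>n. x \<le> 2 ^ n"] by (simp add: n_def)
    then show ?thesis using Suc by simp
  qed
  with n show ?thesis by blast
qed

text \<open>For \<open>\<bar>z\<bar> \<ge> 2\<^sup>I\<close> the term with \<open>2\<^sup>i \<le> \<bar>z\<bar> < 2\<^bsup>i+1\<^esup>\<close> alone is large enough.\<close>

lemma powr_le_dyadic_sum:
  fixes z :: complex
  assumes "2 \<le> p" "cmod z < 2 ^ m"
  shows "cmod z powr p \<le> (2 ^ I) powr p +
    (\<Sum>i\<in>{I..<m}. (2 ^ Suc i) powr (p - 2) * (if 2 ^ i \<le> cmod z then (cmod z)\<^sup>2 else 0))"
  using assms(2)
proof (induction m)
  case 0
  then have "cmod z powr p \<le> (2 ^ I) powr p"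
    using assms(1) by (intro powr_mono2) (auto intro: order_trans[OF less_imp_le one_le_power])
  then show ?case by simp
next
  case (Suc m)
  let ?F = "\<lambda>i. (2 ^ Suc i) powr (p - 2) * (if 2 ^ i \<le> cmod z then (cmod z)\<^sup>2 else 0)"
  have nn: "0 \<le> sum ?F J" for J by (intro sum_nonneg) auto
  show ?case
  proof (cases "m < I")
    case True
    then have "(2::real) ^ Suc m \<le> 2 ^ I" by (intro power_increasing) auto
    then have "cmod z powr p \<le> (2 ^ I) powr p"
      using assms(1) Suc.prems by (intro powr_mono2) auto
    then show ?thesis using nn[of "{I..<Suc m}"] by linarith
  next
    case False
    then have sum: "sum ?F {I..<Suc m} = sum ?F {I..<m} + ?F m" by simp
    show ?thesis
    proof (cases "cmod z < 2 ^ m")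
      case True
      have "0 \<le> ?F m" by simp
      then show ?thesis using Suc.IH[OF True] sum by linarith
    next
      case z: False
      have z0: "0 < cmod z" using z by (smt (verit) zero_less_power)
      have "cmod z powr p = cmod z powr (p - 2) * (cmod z)\<^sup>2"
        using z0 powr_add[of "cmod z" "p - 2" 2] by (simp add: powr_numeral)
      also have "\<dots> \<le> (2 ^ Suc m) powr (p - 2) * (cmod z)\<^sup>2"
        using Suc.prems assms(1) by (intro mult_right_mono powr_mono2) auto
      also have "\<dots> = ?F m" using z by simp
      finally have "cmod z powr p \<le> ?F m" .
      then show ?thesis using nn[of "{I..<m}"] sum powr_ge_zero[of "2 ^ I" p] by linarith
    qed
  qed
qed

lemma integrable_powr:
  assumes [measurable]: "f \<in> borel_measurable borel" and f: "\<And>x. cmod (f x) \<le> C" and "0 \<le> p"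
  shows "integrable unit_lebesgue (\<lambda>x. cmod (f x) powr p)"
  using f assms(3) by (intro integrable_unit_bounded[where C="C powr p"]) (auto intro!: powr_mono2)

lemma moment_le_dyadic_sum:
  assumes m [measurable]: "f \<in> borel_measurable borel" and f: "\<And>x. cmod (f x) < 2 ^ m" and p: "2 \<le> p"
  shows "(LINT x|unit_lebesgue. cmod (f x) powr p) \<le> (2 ^ I) powr p +
    (\<Sum>i\<in>{I..<m}. (2 ^ Suc i) powr (p - 2) * energy (large_part (2 ^ i) f))"
proof -
  have fl: "cmod (f x) \<le> 2 ^ m" for x using f[of x] by simp
  have int: "integrable unit_lebesgue (\<lambda>x. (cmod (large_part l f x))\<^sup>2)" for l
    by (rule integrable_energy[OF _ order_trans[OF large_part_bound fl]]) measurable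
  have "(LINT x|unit_lebesgue. cmod (f x) powr p) \<le> (LINT x|unit_lebesgue. (2 ^ I) powr p +
    (\<Sum>i\<in>{I..<m}. (2 ^ Suc i) powr (p - 2) * (cmod (large_part (2 ^ i) f x))\<^sup>2))"
  proof (rule integral_mono)
    show "integrable unit_lebesgue (\<lambda>x. cmod (f x) powr p)"
      by (rule integrable_powr[OF m fl]) (use p in auto)
    show "integrable unit_lebesgue (\<lambda>x. (2 ^ I) powr p +
      (\<Sum>i\<in>{I..<m}. (2 ^ Suc i) powr (p - 2) * (cmod (large_part (2 ^ i) f x))\<^sup>2))"
      using int by (intro Bochner_Integration.integrable_add Bochner_Integration.integrable_sum
          integrable_mult_right) auto
    fix x
    have "(if 2 ^ i \<le> cmod (f x) then (cmod (f x))\<^sup>2 else 0) = (cmod (large_part (2 ^ i) f x))\<^sup>2" for i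
      by (simp add: large_part_def)
    then show "cmod (f x) powr p \<le> (2 ^ I) powr p +
      (\<Sum>i\<in>{I..<m}. (2 ^ Suc i) powr (p - 2) * (cmod (large_part (2 ^ i) f x))\<^sup>2)"
      using powr_le_dyadic_sum[OF p f, of x I] by simp
  qed
  also have "\<dots> = (2 ^ I) powr p +
    (\<Sum>i\<in>{I..<m}. (2 ^ Suc i) powr (p - 2) * energy (large_part (2 ^ i) f))"
    unfolding energy_def using int
    by (subst Bochner_Integration.integral_add) (auto simp: Bochner_Integration.integral_sum)
  finally show ?thesis .
qed

section \<open>From energies to moments\<close>

text \<open>At most half of the energy lies where \<open>\<bar>f\<bar>\<^sup>2 \<le> energy f / 2\<close>. On the rest \<open>\<bar>f\<bar>\<^sup>p\<close> is at least
  \<open>(energy f / 2)\<^bsup>(p-2)/2\<^esup> \<bar>f\<bar>\<^sup>2\<close>.\<close>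

lemma moment_ge_energy_powr:
  assumes m [measurable]: "f \<in> borel_measurable borel" and f: "\<And>x. cmod (f x) \<le> C" and p: "2 \<le> p"
    and E: "0 < energy f"
  shows "(energy f / 2) powr (p / 2) \<le> (LINT x|unit_lebesgue. cmod (f x) powr p)"
proof -
  define h where "h = energy f / 2"
  define M where "M = (LINT x|unit_lebesgue. cmod (f x) powr p)"
  have h: "0 < h" using E by (simp add: h_def)
  have pw: "h powr ((p - 2) / 2) * (cmod (f x))\<^sup>2 \<le> h powr ((p - 2) / 2) * h + cmod (f x) powr p" for x
  proof (cases "(cmod (f x))\<^sup>2 \<le> h")
    case True
    then show ?thesis by (simp add: add_increasing2 mult_left_mono)
  next
    case False
    then have z: "0 < cmod (f x)" using h by (cases "f x = 0") auto
    have "h powr ((p - 2) / 2) \<le> ((cmod (f x))\<^sup>2) powr ((p - 2) / 2)"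
      using False h p by (intro powr_mono2) auto
    also have "((cmod (f x))\<^sup>2) powr ((p - 2) / 2) = cmod (f x) powr (p - 2)"
    proof -
      have "((cmod (f x))\<^sup>2) powr ((p - 2) / 2) = (cmod (f x) powr 2) powr ((p - 2) / 2)"
        using z by (simp add: powr_numeral)
      also have "\<dots> = cmod (f x) powr (2 * ((p - 2) / 2))" by (rule powr_powr)
      also have "2 * ((p - 2) / 2) = p - 2" by simp
      finally show ?thesis .
    qed
    finally have "h powr ((p - 2) / 2) * (cmod (f x))\<^sup>2 \<le> cmod (f x) powr (p - 2) * (cmod (f x))\<^sup>2"
      by (intro mult_right_mono) auto
    also have "\<dots> = cmod (f x) powr p"
      using z powr_add[of "cmod (f x)" "p - 2" 2] by (simp add: powr_numeral)
    finally show ?thesis using h by (simp add: add_increasing)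
  qed
  have "(LINT x|unit_lebesgue. h powr ((p - 2) / 2) * (cmod (f x))\<^sup>2)
      \<le> (LINT x|unit_lebesgue. h powr ((p - 2) / 2) * h + cmod (f x) powr p)"
    using integrable_energy[OF m f] integrable_powr[OF m f] p pw
    by (intro integral_mono) auto
  then have "h powr ((p - 2) / 2) * (2 * h) \<le> h powr ((p - 2) / 2) * h + M"
    using integrable_energy[OF m f] integrable_powr[OF m f] p
    by (simp add: M_def h_def energy_def)
  then have "h powr ((p - 2) / 2) * h \<le> M" by (simp add: mult.commute)
  moreover have "h powr ((p - 2) / 2) * h = h powr (p / 2)"
    using h powr_add[of h "(p - 2) / 2" 1] by (simp add: diff_divide_distrib)
  ultimately show ?thesis by (simp add: M_def h_def)
qed

text \<open>For \<open>0 \<le> x \<le> 1 / (8 N)\<close> all terms have argument at most \<open>\<pi> / 4\<close>, so there is no cancellation.\<close>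

lemma moment_ge_near_zero:
  assumes S: "S \<subseteq> {1..N}" and N: "1 \<le> N" and p: "0 \<le> p"
  shows "(real (card S) / 2) powr p / (8 * N) \<le> (LINT x|unit_lebesgue. cmod (trig_poly S (\<lambda>_. 1) x) powr p)"
proof -
  define f where "f = trig_poly S (\<lambda>_. 1)"
  define c where "c = (real (card S) / 2) powr p"
  define U where "U = {0..1 / (8 * real N)}"
  have N8: "1 / (8 * real N) \<le> 1" using N by simp
  have U: "U \<subseteq> {0..1}" using N8 unfolding U_def by auto
  have Um: "U \<in> sets borel" by (simp add: U_def)
  have mf: "f \<in> borel_measurable borel" unfolding f_def by measurable
  have fb: "cmod (f x) \<le> card S" for x unfolding f_def by (rule trig_poly_bound) simp
  have mU: "measure unit_lebesgue U = 1 / (8 * N)"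
    using U by (simp add: measure_restrict_space U_def)
  have pw: "c * indicator U x \<le> cmod (f x) powr p" for x
  proof (cases "x \<in> U")
    case True
    have "1 / 2 \<le> Re (e (real n * x))" if "n \<in> S" for n
    proof -
      have nN: "real n \<le> real N" using that S by auto
      have "real n * x \<le> real N * (1 / (8 * real N))"
        using True nN by (intro mult_mono) (auto simp: U_def)
      then have "real n * x \<le> 1 / 8" using N by simp
      then have "2 * pi * (real n * x) \<le> 2 * pi * (1 / 8)" by (intro mult_left_mono) auto
      then have le: "2 * pi * (real n * x) \<le> pi / 3" using pi_gt_zero by linarith
      have "cos (pi / 3) \<le> cos (2 * pi * (real n * x))"
        using le True pi_gt_zero by (intro cos_monotone_0_pi_le) (auto simp: U_def)
      moreover have "Re (e (real n * x)) = cos (2 * pi * (real n * x))"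
        by (simp add: e_def Re_exp)
      ultimately show ?thesis by (simp add: cos_60)
    qed
    then have "(\<Sum>n\<in>S. 1 / 2) \<le> (\<Sum>n\<in>S. Re (e (real n * x)))" by (intro sum_mono) auto
    also have "\<dots> = Re (f x)" by (simp add: f_def trig_poly_def)
    also have "\<dots> \<le> cmod (f x)" by (rule complex_Re_le_cmod)
    finally have "real (card S) / 2 \<le> cmod (f x)" by simp
    then show ?thesis using True p by (simp add: c_def powr_mono2)
  qed auto
  have int: "integrable unit_lebesgue (\<lambda>x. c * indicator U x)"
    using Um by (intro integrable_unit_bounded[where C="\<bar>c\<bar>"]) (auto simp: indicator_def)
  have "c / (8 * N) = c * measure unit_lebesgue U" by (simp add: mU)
  also have "\<dots> = (LINT x|unit_lebesgue. c * indicator U x)"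
    using U by (simp add: Int_absorb2)
  also have "\<dots> \<le> (LINT x|unit_lebesgue. cmod (f x) powr p)"
    using pw by (intro integral_mono int integrable_powr[OF mf fb p])
  finally show ?thesis by (simp add: c_def f_def)
qed

lemma sum_inverse_powers_2: "(\<Sum>i\<in>{I..<m}. 1 / 2 ^ i) \<le> 2 / (2::real) ^ I"
proof -
  have "(\<Sum>i\<in>{I..<m}. 1 / 2 ^ i) = 2 / (2::real) ^ I - 2 / 2 ^ m" if "I \<le> m"
    using that by (induction m rule: dec_induct) auto
  then show ?thesis by (cases "I \<le> m") (auto simp: not_le)
qed

lemma sum_geometric_le:
  assumes "1 < (q::real)"
  shows "(\<Sum>i\<in>{I..<m}. q ^ Suc i) \<le> q / (q - 1) * q ^ m"
proof -
  have "(\<Sum>i\<in>{I..<m}. q ^ Suc i) \<le> (\<Sum>i<m. q ^ Suc i)"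
    using assms by (intro sum_mono2) auto
  also have "\<dots> = q * (\<Sum>i<m. q ^ i)" by (simp add: sum_distrib_left)
  also have "\<dots> = q * ((q ^ m - 1) / (q - 1))" using assms by (simp add: geometric_sum)
  also have "\<dots> \<le> q * (q ^ m / (q - 1))"
    using assms by (intro mult_left_mono divide_right_mono) auto
  finally show ?thesis by simp
qed

lemma power_2_powr: "(2 ^ k) powr a = (2 powr a) ^ k" for a :: real
proof -
  have "(2 ^ k) powr a = (2 powr real k) powr a" by (simp add: powr_realpow)
  also have "\<dots> = 2 powr (real k * a)" by (rule powr_powr)
  also have "\<dots> = (2 powr a) ^ k" by (simp add: powr_power mult.commute)
  finally show ?thesis .
qed

text \<open>In the sum over the levels \<open>2\<^sup>i\<close>, the first part of the hypothesis contributes a geometric series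
  that decreases in \<open>i\<close> and is dominated by the lowest level, of order \<open>\<surd>R\<close>. The second part
  contributes an increasing series dominated by the highest level, of order \<open>R\<close>. The latter needs
  \<open>p > 2\<close>.\<close>

lemma moment_le_of_energy_decay:
  fixes p R K0 C1 :: real
  assumes p: "2 < p" and R: "1 \<le> R" and K0: "1 \<le> K0" and C1: "0 \<le> C1" and N: "1 \<le> (N::nat)"
    and S: "card S \<le> 4 * R" and b: "\<And>n. n \<in> S \<Longrightarrow> cmod (b n) \<le> 1"
    and decay: "\<And>i. K0 * sqrt R \<le> 2 ^ i \<Longrightarrow> 2 ^ i \<le> 5 * R \<Longrightarrow>
      energy (large_part (2 ^ i) (trig_poly S b)) \<le> (2 ^ i)\<^sup>2 * (sqrt R / 2 ^ i) powr (p + 1) + C1 * R\<^sup>2 / N"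
  shows "(LINT x|unit_lebesgue. cmod (trig_poly S b x) powr p) \<le>
    ((2 * K0) powr p + 2 powr (p - 1) + C1 * (2 powr (p - 2) / (2 powr (p - 2) - 1)) * 10 powr (p - 2))
      * (R powr (p / 2) + R powr p / N)"
proof -
  define f where "f = trig_poly S b"
  define r where "r = sqrt R"
  define q where "q = (2::real) powr (p - 2)"
  have r: "1 \<le> r" using R by (simp add: r_def)
  have q: "1 < q" using p powr_less_mono[of 0 "p - 2" 2] by (simp add: q_def)
  have rp: "r powr p = R powr (p / 2)"
    using R by (simp add: r_def powr_half_sqrt[symmetric] powr_powr)
  have fb: "cmod (f x) \<le> card S" for x unfolding f_def by (rule trig_poly_bound[OF b])
  have mf: "f \<in> borel_measurable borel" unfolding f_def by measurable
  have "1 \<le> K0 * r" using mult_mono[of 1 K0 1 r] K0 r by simp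
  then obtain I where I: "K0 * r \<le> 2 ^ I" "2 ^ I \<le> 2 * (K0 * r)" using power2_sandwich by blast
  obtain m where m: "real (card S) + 1 \<le> 2 ^ m" "2 ^ m \<le> 2 * (real (card S) + 1)"
    using power2_sandwich[of "real (card S) + 1"] by auto
  have "2 * (real (card S) + 1) \<le> 10 * R" using S R by simp
  then have m10: "2 ^ m \<le> 10 * R" using m(2) by (rule order_trans[rotated])
  have fm: "cmod (f x) < 2 ^ m" for x using fb[of x] m(1) by linarith
  have level: "(2 ^ Suc i) powr (p - 2) * energy (large_part (2 ^ i) f)
      \<le> q * r powr (p + 1) * (1 / 2 ^ i) + C1 * R\<^sup>2 / N * q ^ Suc i" if i: "i \<in> {I..<m}" for i
  proof -
    define y where "y = (2::real) ^ i"
    have y: "0 < y" by (simp add: y_def)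
    have "(2::real) ^ I \<le> 2 ^ i" "(2::real) ^ Suc i \<le> 2 ^ m"
      using i by (auto simp del: power_Suc intro!: power_increasing)
    then have "K0 * sqrt R \<le> 2 ^ i" "2 ^ i \<le> 5 * R"
      using order_trans[OF I(1)] order_trans[of "2 ^ Suc i", OF _ m10] by (auto simp: r_def)
    then have "energy (large_part y f) \<le> y\<^sup>2 * (r / y) powr (p + 1) + C1 * R\<^sup>2 / N"
      unfolding y_def f_def r_def by (rule decay)
    then have "(2 * y) powr (p - 2) * energy (large_part y f)
        \<le> (2 * y) powr (p - 2) * (y\<^sup>2 * (r / y) powr (p + 1) + C1 * R\<^sup>2 / N)"
      by (intro mult_left_mono) auto
    also have "\<dots> = (2 * y) powr (p - 2) * (y\<^sup>2 * (r / y) powr (p + 1)) + (2 * y) powr (p - 2) * (C1 * R\<^sup>2 / N)"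
      by (simp add: distrib_left)
    also have "(2 * y) powr (p - 2) * (y\<^sup>2 * (r / y) powr (p + 1)) = q * r powr (p + 1) * (1 / y)"
    proof -
      have "y powr (p - 2) * y\<^sup>2 = y powr p"
        using y powr_add[of y "p - 2" 2] by (simp add: powr_numeral)
      moreover have "y powr (p + 1) = y powr p * y" using y by (simp add: powr_add)
      ultimately show ?thesis
        using y r by (simp add: powr_mult powr_divide q_def field_simps)
    qed
    also have "(2 * y) powr (p - 2) = q ^ Suc i"
      using power_2_powr[of "Suc i" "p - 2"] by (simp add: y_def q_def)
    finally show ?thesis
      using power_2_powr[of "Suc i" "p - 2"] by (simp add: y_def q_def[symmetric] mult.commute)
  qed
  have "(LINT x|unit_lebesgue. cmod (f x) powr p) \<le> (2 ^ I) powr p +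
    (\<Sum>i\<in>{I..<m}. (2 ^ Suc i) powr (p - 2) * energy (large_part (2 ^ i) f))"
    using p by (intro moment_le_dyadic_sum[OF mf fm]) auto
  also have "\<dots> \<le> (2 ^ I) powr p +
    (\<Sum>i\<in>{I..<m}. q * r powr (p + 1) * (1 / 2 ^ i) + C1 * R\<^sup>2 / N * q ^ Suc i)"
    by (intro add_left_mono sum_mono level)
  also have "\<dots> = (2 ^ I) powr p + (q * r powr (p + 1) * (\<Sum>i\<in>{I..<m}. 1 / 2 ^ i)
      + C1 * R\<^sup>2 / N * (\<Sum>i\<in>{I..<m}. q ^ Suc i))"
    by (simp only: sum.distrib sum_distrib_left)
  also have "\<dots> \<le> (2 * K0) powr p * r powr p + (2 * q * r powr p
      + C1 * (q / (q - 1)) * 10 powr (p - 2) * (R powr p / N))"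
  proof (intro add_mono)
    have "(2 ^ I) powr p \<le> (2 * K0 * r) powr p" using I p by (intro powr_mono2) auto
    then show "(2 ^ I) powr p \<le> (2 * K0) powr p * r powr p"
      using K0 r by (simp add: powr_mult)
    have "1 * r \<le> K0 * r" using K0 r by (intro mult_right_mono) auto
    then have "r \<le> 2 ^ I" using I(1) by simp
    then have "2 / 2 ^ I \<le> 2 / r" using r by (intro divide_left_mono) auto
    then have "(\<Sum>i\<in>{I..<m}. 1 / 2 ^ i) \<le> 2 / r" using sum_inverse_powers_2[of I m] by linarith
    then have "q * r powr (p + 1) * (\<Sum>i\<in>{I..<m}. 1 / 2 ^ i) \<le> q * r powr (p + 1) * (2 / r)"
      using q by (intro mult_left_mono) auto
    also have "\<dots> = 2 * q * r powr p" using r by (simp add: powr_add)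
    finally show "q * r powr (p + 1) * (\<Sum>i\<in>{I..<m}. 1 / 2 ^ i) \<le> 2 * q * r powr p" .
    have "q ^ m = (2 ^ m) powr (p - 2)"
      by (simp add: q_def power_2_powr)
    also have "\<dots> \<le> (10 * R) powr (p - 2)" using m10 p by (intro powr_mono2) auto
    also have "\<dots> = 10 powr (p - 2) * R powr (p - 2)" using R by (simp add: powr_mult)
    finally have qm: "q ^ m \<le> 10 powr (p - 2) * R powr (p - 2)" .
    have "(\<Sum>i\<in>{I..<m}. q ^ Suc i) \<le> q / (q - 1) * q ^ m" by (rule sum_geometric_le[OF q])
    also have "\<dots> \<le> q / (q - 1) * (10 powr (p - 2) * R powr (p - 2))"
      using q by (intro mult_left_mono qm) auto
    finally have "C1 * R\<^sup>2 / N * (\<Sum>i\<in>{I..<m}. q ^ Suc i)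
        \<le> C1 * R\<^sup>2 / N * (q / (q - 1) * (10 powr (p - 2) * R powr (p - 2)))"
      using C1 by (intro mult_left_mono) auto
    also have "\<dots> = C1 * (q / (q - 1)) * 10 powr (p - 2) * ((R powr (p - 2) * R\<^sup>2) / N)"
      by (simp add: mult_ac)
    also have "R powr (p - 2) * R\<^sup>2 = R powr p"
      using R powr_add[of R "p - 2" 2] by (simp add: powr_numeral)
    finally show "C1 * R\<^sup>2 / N * (\<Sum>i\<in>{I..<m}. q ^ Suc i)
        \<le> C1 * (q / (q - 1)) * 10 powr (p - 2) * (R powr p / N)" .
  qed
  also have "\<dots> = ((2 * K0) powr p + 2 powr (p - 1)) * R powr (p / 2)
      + C1 * (q / (q - 1)) * 10 powr (p - 2) * (R powr p / N)"
  proof -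
    have "2 * q = 2 powr (p - 1)" using powr_add[of 2 1 "p - 2"] by (simp add: q_def)
    then show ?thesis by (simp add: rp algebra_simps)
  qed
  also have "\<dots> \<le> ((2 * K0) powr p + 2 powr (p - 1) + C1 * (q / (q - 1)) * 10 powr (p - 2))
      * (R powr (p / 2) + R powr p / N)"
  proof -
    have "0 \<le> C1 * (q / (q - 1)) * 10 powr (p - 2)" using C1 q by simp
    moreover have "0 \<le> (2 * K0) powr p + 2 powr (p - 1)" by simp
    moreover have "0 \<le> R powr (p / 2)" "0 \<le> R powr p / N" by simp_all
    ultimately show ?thesis unfolding distrib_left distrib_right
      by (smt (verit) mult_nonneg_nonneg distrib_right)
  qed
  finally show ?thesis by (simp add: f_def q_def)
qed

text \<open>The eighth root of \<open>K = 2\<^sup>i / \<surd>R\<close>. It plays the role of \<open>B\<close>: a power of \<open>K\<close> so small that the factors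
  \<open>B\<^sup>2\<close> lost in each round are negligible against \<open>K\<close>, but still large.\<close>

definition dyadic_ratio :: "real \<Rightarrow> nat \<Rightarrow> real" where
  "dyadic_ratio R i = (2 ^ i / sqrt R) powr (1 / 8)"

lemma dyadic_ratio_power:
  assumes "0 < R"
  shows "0 < dyadic_ratio R i" "dyadic_ratio R i ^ 8 * sqrt R = 2 ^ i"
  using assms by (auto simp: dyadic_ratio_def powr_powr simp flip: powr_realpow)

definition uniform_set :: "real \<Rightarrow> nat \<Rightarrow> nat \<Rightarrow> nat set \<Rightarrow> bool" where
  "uniform_set R N J S \<longleftrightarrow> (\<forall>i\<in>{..5 * N}. \<forall>j\<in>{..<J}. \<forall>t\<in>{1..N}.
    word_uniform N (energy_floor R N (dyadic_ratio R i)) (2 ^ i / 32 ^ j / 2)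
      (dyadic_ratio R i * sample_length (dyadic_ratio R i) (2 ^ i) t)
      (sample_length (dyadic_ratio R i) (2 ^ i) t) t S)"

text \<open>A union bound over at most \<open>6 J N\<^sup>2\<close> triples of a level, a round and a number of frequencies.\<close>

lemma uniform_set_fails_prob:
  assumes bf: "bernoulli_family \<tau> N M \<xi>" and \<tau>: "0 < \<tau>" "\<tau> \<le> 1" and N: "2 \<le> N"
  shows "measure M {\<omega>\<in>space M. \<not> uniform_set (\<tau> * N) N J (random_set N \<xi> \<omega>)} \<le> 6 * J / N"
proof -
  interpret prob_space M by (rule bernoulli_familyD[OF bf])
  define R where "R = \<tau> * N"
  have R: "0 < R" using \<tau> N by (simp add: R_def)
  define B where "B = dyadic_ratio R"
  define X where "X = {..5 * N} \<times> {..<J} \<times> {1..N}"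
  define Bad where "Bad = (\<lambda>(i, j, t). {\<omega>\<in>space M. \<not> word_uniform N (energy_floor R N (B i))
      (2 ^ i / 32 ^ j / 2) (B i * sample_length (B i) (2 ^ i) t) (sample_length (B i) (2 ^ i) t) t
      (random_set N \<xi> \<omega>)})"
  have bad: "measure M (Bad z) \<le> real N powr (- 5)" if z: "z \<in> X" for z
  proof -
    obtain i j t where z_eq: "z = (i, j, t)" and t: "1 \<le> t" using z by (auto simp: X_def)
    have B: "0 < B i" unfolding B_def by (rule dyadic_ratio_power[OF R])
    have "0 < B i * (real t / 2 ^ i)\<^sup>2" using B t by simp
    then have "1 \<le> sample_length (B i) (2 ^ i) t" unfolding sample_length_def by linarith
    from word_uniform_fails_prob[OF bf \<tau> N B this] show ?thesis
      by (simp add: z_eq Bad_def R_def)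
  qed
  have "{\<omega>\<in>space M. \<not> uniform_set R N J (random_set N \<xi> \<omega>)} = (\<Union>z\<in>X. Bad z)"
    unfolding uniform_set_def X_def Bad_def B_def by blast
  also have "measure M \<dots> \<le> (\<Sum>z\<in>X. measure M (Bad z))"
    using sets_random_set[OF bf] unfolding Bad_def X_def
    by (intro finite_measure_subadditive_finite) (auto split: prod.splits)
  also have "\<dots> \<le> (\<Sum>z\<in>X. real N powr (- 5))" by (rule sum_mono[OF bad])
  also have "\<dots> = (5 * real N + 1) * J * N * real N powr (- 5)"
    by (simp add: X_def card_cartesian_product algebra_simps)
  also have "\<dots> \<le> (6 * real N) * J * N * real N powr (- 5)"
    using N by (intro mult_right_mono) auto
  also have "\<dots> = 6 * J * real N powr (- 3)"
  proof -
    have "real N powr (- 3) = real N powr (1 + 1 + - 5)" by simp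
    also have "\<dots> = real N * real N * real N powr (- 5)" using N by (subst powr_add, subst powr_add) simp
    finally show ?thesis by simp
  qed
  also have "\<dots> \<le> 6 * J * real N powr (- 1)"
    using N by (intro mult_left_mono powr_mono) auto
  also have "\<dots> = 6 * J / N" using N by (simp add: powr_minus_divide)
  finally show ?thesis by (simp add: R_def)
qed

section \<open>The majorant inequality\<close>

lemma exp_beats_power_ev:
  fixes a c :: real and D :: nat
  assumes "0 < a"
  shows "eventually (\<lambda>B. c * B ^ D * exp (- B / a) \<le> 1) at_top"
proof -
  have "((\<lambda>x. x ^ D / exp x) \<longlongrightarrow> 0) (at_top :: real filter)"
    by (rule tendsto_power_div_exp_0)
  moreover have "filterlim (\<lambda>B. B / a) at_top (at_top :: real filter)"
    using assms by real_asymp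
  ultimately have "((\<lambda>B. (B / a) ^ D / exp (B / a)) \<longlongrightarrow> 0) at_top"
    by (rule filterlim_compose)
  then have "((\<lambda>B. c * a ^ D * ((B / a) ^ D / exp (B / a))) \<longlongrightarrow> 0) at_top"
    by (rule tendsto_mult_right_zero)
  moreover have "(\<lambda>B. c * a ^ D * ((B / a) ^ D / exp (B / a))) = (\<lambda>B. c * B ^ D * exp (- B / a))"
    using assms by (simp add: power_divide exp_minus field_simps)
  ultimately have "((\<lambda>B. c * B ^ D * exp (- B / a)) \<longlongrightarrow> 0) at_top" by simp
  then have "eventually (\<lambda>B. c * B ^ D * exp (- B / a) < 1) at_top"
    by (rule order_tendstoD) simp
  then show ?thesis by eventually_elim simp
qed

lemma powr_beats_ln_power_ev:
  fixes a c :: real and D :: nat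
  assumes "0 < a"
  shows "eventually (\<lambda>x. c * ln x ^ D \<le> x powr a) at_top"
proof -
  have "eventually (\<lambda>B. c * B ^ D * exp (- B / (1 / a)) \<le> 1) at_top"
    using assms by (intro exp_beats_power_ev) simp
  then have "eventually (\<lambda>x. c * ln x ^ D * exp (- ln x / (1 / a)) \<le> 1) at_top"
    using ln_at_top by (rule eventually_compose_filterlim)
  then show ?thesis
    using eventually_gt_at_top[of 0]
    by eventually_elim (simp add: powr_def exp_minus field_simps)
qed

text \<open>The constant factor in the second alternative of \<open>energy_large_part_bound\<close> when \<open>Q\<close> is the
  energy floor.\<close>

definition spread_const :: "nat \<Rightarrow> real" where
  "spread_const J = 2048 ^ J * 8 * (8 * exp 1)\<^sup>2"

text \<open>The factor \<open>N\<^bsup>16/B\<^esup>\<close> in the second alternative of \<open>energy_large_part_bound\<close> has to be removed.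
  If \<open>B \<ge> ln N\<close>, then it is at most \<open>exp 16\<close>. If \<open>B < ln N\<close>, then it is still at most
  \<open>N\<^bsup>\<delta>/2\<^esup>\<close>, and the second alternative bounds the energy by a constant times \<open>R N\<^bsup>-\<delta>/2\<^esup>\<close>.
  As \<open>N\<close> is so large that \<open>N\<^bsup>\<delta>/2\<^esup>\<close> beats the relevant power of \<open>ln N > B\<close>, the first term on the
  right-hand side is larger.\<close>

lemma uniform_set_energy_decay:
  fixes \<delta> p B0 R :: real and J N i :: nat
  assumes \<delta>: "0 < \<delta>" and p: "0 \<le> p" and J: "2 * (p + 1) \<le> J"
    and B0: "2 \<le> B0" "2048 ^ J \<le> B0" "32 / \<delta> \<le> B0"
      "\<And>B. B0 \<le> B \<Longrightarrow> 256 * (576 * 32 ^ J)\<^sup>2 * 2048 ^ J * B ^ (4 * J) * exp (- B / (9216 * 1024 ^ J)) \<le> 1"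
    and N: "2 \<le> N" "spread_const J * ln N ^ (4 * J) \<le> N powr (\<delta> / 2)" and R: "R = N powr (1 - \<delta>)"
    and S: "S \<subseteq> {1..N}" "card S \<le> 4 * R" "uniform_set R N J S"
    and b: "\<And>n. n \<in> S \<Longrightarrow> cmod (b n) \<le> 1"
    and i: "B0 ^ 8 * sqrt R \<le> 2 ^ i" "2 ^ i \<le> 5 * R"
  shows "energy (large_part (2 ^ i) (trig_poly S b))
    \<le> (2 ^ i)\<^sup>2 * (sqrt R / 2 ^ i) powr (p + 1) + spread_const J * exp 16 * R\<^sup>2 / N"
proof -
  define B where "B = dyadic_ratio R i"
  define Q where "Q = energy_floor R N B"
  define E where "E = energy (large_part (2 ^ i) (trig_poly S b))"
  define y where "y = (2::real) ^ i"
  have N0: "0 < real N" using N by simp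
  have R0: "0 < R" using N0 by (simp add: R)
  have Bpos: "0 < B" and lam: "y = B ^ 8 * sqrt R"
    using dyadic_ratio_power[OF R0] by (auto simp: B_def y_def)
  have y0: "0 < y" by (simp add: y_def)
  have "B0 ^ 8 \<le> B ^ 8" using i(1) R0 lam by (simp add: y_def)
  then have BB: "B0 \<le> B" using Bpos B0(1) by (simp add: power_mono_iff)
  have B1: "1 \<le> B" using BB B0 by linarith
  have Q: "0 < Q" using R0 N0 by (simp add: Q_def energy_floor_def)
  have RN: "R \<le> N" using powr_mono[of "1 - \<delta>" 1 "real N"] N \<delta> by (simp add: R)
  have iN: "i \<in> {..5 * N}"
  proof -
    have "real i < 2 ^ i" by (rule of_nat_less_two_power)
    then have "real i \<le> 5 * real N" using i(2) RN by linarith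
    then show ?thesis by simp
  qed
  have uniform: "word_uniform N Q (y / 32 ^ j / 2) (B * sample_length B y t) (sample_length B y t) t S"
    if "j < J" "t \<in> {1..N}" for j t
    using S(3) iN that unfolding uniform_set_def Q_def B_def y_def by blast
  have "E \<le> y\<^sup>2 / B ^ (4 * J) \<or> N * E \<le> 2048 ^ J * 8 * Q"
    unfolding E_def y_def[symmetric]
    by (rule energy_large_part_bound[OF S(1,2) b R0 lam Q _ _ B0(4)[OF BB] uniform])
      (use BB B0 in auto)
  then have dichotomy: "E \<le> y\<^sup>2 / B ^ (4 * J) \<or> E \<le> spread_const J * R\<^sup>2 * N powr (16 / B) / N"
    using N0 by (simp add: Q_def energy_floor_def spread_const_def power_mult_distrib field_simps)
  have "sqrt R / y = B powr (- 8)"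
    using R0 Bpos by (simp add: lam powr_minus powr_numeral field_simps)
  then have decay_eq: "(sqrt R / y) powr (p + 1) = B powr (- (8 * (p + 1)))"
    by (simp add: powr_powr)
  have "B powr (8 * (p + 1)) \<le> B powr (4 * J)" using J B1 by (intro powr_mono) auto
  also have "\<dots> = B ^ (4 * J)" using Bpos powr_realpow[of B "4 * J"] by simp
  finally have BJ: "B powr (8 * (p + 1)) \<le> B ^ (4 * J)" .
  have spread: "0 < spread_const J" by (simp add: spread_const_def)
  have nonneg: "0 \<le> y\<^sup>2 * (sqrt R / y) powr (p + 1)" "0 \<le> spread_const J * exp 16 * R\<^sup>2 / N"
    using spread by simp_all
  have "E \<le> y\<^sup>2 * (sqrt R / y) powr (p + 1) \<or> E \<le> spread_const J * exp 16 * R\<^sup>2 / N"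
  proof (cases "E \<le> y\<^sup>2 / B ^ (4 * J)")
    case True
    also have "y\<^sup>2 / B ^ (4 * J) \<le> y\<^sup>2 / B powr (8 * (p + 1))"
      using BJ Bpos by (intro divide_left_mono) auto
    also have "\<dots> = y\<^sup>2 * (sqrt R / y) powr (p + 1)"
      unfolding decay_eq powr_minus_divide by simp
    finally show ?thesis by simp
  next
    case False
    then have E: "E \<le> spread_const J * R\<^sup>2 * N powr (16 / B) / N" using dichotomy by blast
    show ?thesis
    proof (cases "ln N \<le> B")
      case True
      have "N powr (16 / B) = exp (16 * (ln N / B))" using N0 by (simp add: powr_def)
      also have "\<dots> \<le> exp (16 * 1)"
      proof -
        have "ln N / B \<le> 1" using True Bpos by (simp add: divide_le_eq)
        then show ?thesis by (simp only: exp_le_cancel_iff)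
      qed
      finally have "N powr (16 / B) \<le> exp 16" by simp
      then have "spread_const J * R\<^sup>2 * N powr (16 / B) / N \<le> spread_const J * R\<^sup>2 * exp 16 / N"
        using spread by (intro divide_right_mono mult_left_mono) auto
      with E show ?thesis by (simp add: mult_ac)
    next
      case False
      have "16 / B \<le> \<delta> / 2"
      proof -
        have "32 / \<delta> \<le> B" using BB B0(3) by linarith
        then show ?thesis using \<delta> Bpos by (simp add: field_simps)
      qed
      then have "N powr (16 / B) \<le> N powr (\<delta> / 2)" using N by (intro powr_mono) auto
      then have "E \<le> spread_const J * R\<^sup>2 * N powr (\<delta> / 2) / N"
        using E spread by (elim order_trans) (intro divide_right_mono mult_left_mono, auto)
      also have "\<dots> = R * (spread_const J * N powr (- (\<delta> / 2)))"
      proof -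
        have "R * N powr (\<delta> / 2) / N = N powr ((1 - \<delta>) + \<delta> / 2 - 1)"
          using N0 unfolding R powr_diff powr_add by simp
        also have "(1 - \<delta>) + \<delta> / 2 - 1 = - (\<delta> / 2)" by simp
        finally have *: "R * N powr (\<delta> / 2) / N = N powr (- (\<delta> / 2))" .
        show ?thesis unfolding *[symmetric] by (simp add: power2_eq_square)
      qed
      also have "\<dots> \<le> R * (B ^ 16 * B powr (- (8 * (p + 1))))"
      proof (rule mult_left_mono)
        have "spread_const J * B powr (8 * (p + 1)) \<le> spread_const J * B ^ (4 * J)"
          using BJ spread by simp
        also have "\<dots> \<le> spread_const J * ln N ^ (4 * J)"
          using False Bpos spread by (intro mult_left_mono power_mono) auto
        also have "\<dots> \<le> N powr (\<delta> / 2)" by (rule N(2))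
        finally have "spread_const J * N powr (- (\<delta> / 2)) \<le> B powr (- (8 * (p + 1)))"
          using N0 Bpos unfolding powr_minus by (simp add: field_simps)
        also have "\<dots> \<le> B ^ 16 * B powr (- (8 * (p + 1)))"
          using mult_right_mono[OF one_le_power[OF B1, of 16], of "B powr (- (8 * (p + 1)))"] by simp
        finally show "spread_const J * N powr (- (\<delta> / 2)) \<le> B ^ 16 * B powr (- (8 * (p + 1)))" .
      qed (use R0 in auto)
      also have "\<dots> = y\<^sup>2 * (sqrt R / y) powr (p + 1)"
        unfolding decay_eq using R0 by (simp add: lam power_mult_distrib flip: power_mult)
      finally show ?thesis by simp
    qed
  qed
  with nonneg show ?thesis unfolding E_def y_def by linarith
qed

lemma moment_eq_energy: "(LINT x|unit_lebesgue. cmod (f x) powr 2) = energy f"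
  unfolding energy_def by (intro Bochner_Integration.integral_cong) auto

text \<open>The two lower bounds for the moment of the polynomial with all coefficients 1, added.\<close>

lemma moment_ratio_bound:
  fixes p R :: real
  assumes p: "2 \<le> p" and N: "1 \<le> N" and S: "S \<subseteq> {1..N}" "R / 4 \<le> card S" and R: "0 < R"
  shows "R powr (p / 2) + R powr p / N
    \<le> 2 * 8 powr (p + 1) * (LINT x|unit_lebesgue. cmod (trig_poly S (\<lambda>_. 1) x) powr p)"
proof -
  define m where "m = (LINT x|unit_lebesgue. cmod (trig_poly S (\<lambda>_. 1) x) powr p)"
  have fS: "finite S" using S finite_subset by blast
  have en: "energy (trig_poly S (\<lambda>_. 1)) = card S" by (simp add: energy_trig_poly[OF fS])
  have c0: "0 < real (card S)" using S R by linarith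
  have "(R / 8) powr (p / 2) \<le> (real (card S) / 2) powr (p / 2)"
    using S R p by (intro powr_mono2) auto
  also have "\<dots> \<le> m"
    using moment_ge_energy_powr[OF borel_trig_poly[where T=S and b="\<lambda>_. 1"] trig_poly_bound' p] c0
    by (simp add: en m_def)
  finally have "R powr (p / 2) \<le> 8 powr (p / 2) * m"
    using R by (simp add: powr_divide field_simps)
  also have "\<dots> \<le> 8 powr (p + 1) * m"
    using p by (intro mult_right_mono powr_mono) (auto simp: m_def intro!: integral_nonneg_AE)
  finally have 1: "R powr (p / 2) \<le> 8 powr (p + 1) * m" .
  have "(R / 8) powr p / (8 * N) \<le> (real (card S) / 2) powr p / (8 * N)"
    using S R p by (intro divide_right_mono powr_mono2) auto
  also have "\<dots> \<le> m"
    using moment_ge_near_zero[OF S(1) N, of p] p by (simp add: m_def)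
  finally have 2: "R powr p / N \<le> 8 powr (p + 1) * m"
    using R N by (simp add: powr_divide powr_add field_simps)
  show ?thesis using 1 2 by (simp add: m_def[symmetric])
qed

lemma Lp_norm_trig_poly:
  "Lp_norm p (\<lambda>x. \<Sum>n\<in>S. b n * e (real n * x))
    = (LINT x|unit_lebesgue. cmod (trig_poly S b x) powr p) powr (1 / p)"
  by (simp add: Lp_norm_def trig_poly_def)

text \<open>The constant is \<open>A + 1\<close> instead of \<open>A\<close> to make the inequality strict, so that it excludes the event
  of the theorem, which is defined by a weak inequality.\<close>

lemma majorant_of_moment_bounds:
  fixes p V A :: real
  assumes p: "0 < p" and A: "0 \<le> A" and S: "S \<subseteq> {1..N}"
    and upper: "\<And>b. (\<And>n. n \<in> S \<Longrightarrow> cmod (b n) \<le> 1) \<Longrightarrow>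
      (LINT x|unit_lebesgue. cmod (trig_poly S b x) powr p) \<le> A * m"
    and m: "m = (LINT x|unit_lebesgue. cmod (trig_poly S (\<lambda>_. 1) x) powr p)" "0 < m"
  shows "sup_norm_coeffs p N S < (A + 1) powr (1 / p) * Lp_norm p (\<lambda>x. \<Sum>n\<in>S. e (real n * x))"
proof -
  have "sup_norm_coeffs p N S \<le> (A * m) powr (1 / p)"
    unfolding sup_norm_coeffs_def Lp_norm_trig_poly
  proof (rule cSUP_least[OF unit_bounded_nonempty])
    fix a assume "a \<in> unit_bounded N"
    then have "\<And>n. n \<in> S \<Longrightarrow> cmod (a n) \<le> 1" using S by (auto simp: unit_bounded_def)
    from upper[OF this] show "(LINT x|unit_lebesgue. cmod (trig_poly S a x) powr p) powr (1 / p)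
        \<le> (A * m) powr (1 / p)"
      using p by (intro powr_mono2) (auto intro!: integral_nonneg_AE)
  qed
  also have "\<dots> < ((A + 1) * m) powr (1 / p)"
    using p A m by (intro powr_less_mono2) auto
  also have "\<dots> = (A + 1) powr (1 / p) * m powr (1 / p)"
    using A m by (simp add: powr_mult)
  also have "m powr (1 / p) = Lp_norm p (\<lambda>x. \<Sum>n\<in>S. e (real n * x))"
    using Lp_norm_trig_poly[where S=S and b="\<lambda>_. 1"] by (simp add: m)
  finally show ?thesis .
qed

theorem theorem1p2:
  fixes \<delta> p \<gamma> :: real
  assumes "0 < \<delta>" "\<delta> < 1" "p \<ge> 2" "\<gamma> > 0"
  shows "\<exists>C C' :: real.
    \<forall>(M :: nat \<Rightarrow> 'w measure) (\<xi> :: nat \<Rightarrow> nat \<Rightarrow> 'w \<Rightarrow> nat).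
      (\<forall>N\<ge>1. bernoulli_family (real N powr (-\<delta>)) N (M N) (\<xi> N)) \<longrightarrow>
      (SUP N\<in>{N. N \<ge> 1 \<and> real N \<ge> C'}.
         measure (M N)
           {\<omega>\<in>space (M N).
              sup_norm_coeffs p N (random_set N (\<xi> N) \<omega>)
                \<ge> C * Lp_norm p (\<lambda>x. \<Sum>n\<in>random_set N (\<xi> N) \<omega>. e (real n * x))})
      \<le> \<gamma>"
proof -
  \<comment> \<open>\<open>J\<close> rounds give \<open>B\<^bsup>-4J\<^esup> \<le> K\<^bsup>-(p+1)\<^esup>\<close>, as \<open>K = B\<^sup>8\<close>.\<close>
  define J where "J = nat \<lceil>2 * (p + 1)\<rceil>"
  have J: "2 * (p + 1) \<le> real J" unfolding J_def by linarith
  \<comment> \<open>Levels with \<open>B < B0\<close>, that is below \<open>B0\<^sup>8 \<surd>R\<close>, are bounded trivially and enter the constant \<open>C2\<close>.\<close>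
  have "eventually (\<lambda>B. 2 \<le> B \<and> 2048 ^ J \<le> B \<and> 32 / \<delta> \<le> B \<and>
      256 * (576 * 32 ^ J)\<^sup>2 * 2048 ^ J * B ^ (4 * J) * exp (- B / (9216 * 1024 ^ J)) \<le> 1) at_top"
    by (intro eventually_conj eventually_ge_at_top exp_beats_power_ev) simp
  then obtain B0 where B0': "\<And>B. B0 \<le> B \<Longrightarrow> 2 \<le> B \<and> 2048 ^ J \<le> B \<and> 32 / \<delta> \<le> B \<and>
      256 * (576 * 32 ^ J)\<^sup>2 * 2048 ^ J * B ^ (4 * J) * exp (- B / (9216 * 1024 ^ J)) \<le> 1"
    unfolding eventually_at_top_linorder by blast
  then have B0: "2 \<le> B0" "2048 ^ J \<le> B0" "32 / \<delta> \<le> B0"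
    "\<And>B. B0 \<le> B \<Longrightarrow> 256 * (576 * 32 ^ J)\<^sup>2 * 2048 ^ J * B ^ (4 * J) * exp (- B / (9216 * 1024 ^ J)) \<le> 1"
    by auto
  define C1 where "C1 = spread_const J * exp 16"
  define C2 where "C2 = max 4 ((2 * B0 ^ 8) powr p + 2 powr (p - 1)
    + C1 * (2 powr (p - 2) / (2 powr (p - 2) - 1)) * 10 powr (p - 2))"
  define A where "A = C2 * (2 * 8 powr (p + 1))"
  have "((\<lambda>x. 6 * real J / x + exp (- (x powr (1 - \<delta>))) + exp (- (x powr (1 - \<delta>)) / 4)) \<longlongrightarrow> 0) at_top"
    using assms by real_asymp
  then have "eventually (\<lambda>x. 6 * real J / x + exp (- (x powr (1 - \<delta>))) + exp (- (x powr (1 - \<delta>)) / 4) < \<gamma>) at_top"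
    using assms by (intro order_tendstoD)
  moreover have "eventually (\<lambda>x. spread_const J * ln x ^ (4 * J) \<le> x powr (\<delta> / 2)) at_top"
    using assms by (intro powr_beats_ln_power_ev) simp
  ultimately have "eventually (\<lambda>x. 2 \<le> x \<and>
      6 * real J / x + exp (- (x powr (1 - \<delta>))) + exp (- (x powr (1 - \<delta>)) / 4) < \<gamma> \<and>
      spread_const J * ln x ^ (4 * J) \<le> x powr (\<delta> / 2)) at_top"
    by (intro eventually_conj eventually_ge_at_top)
  then obtain N0 where N0: "\<And>x. N0 \<le> x \<Longrightarrow> 2 \<le> x \<and>
      6 * real J / x + exp (- (x powr (1 - \<delta>))) + exp (- (x powr (1 - \<delta>)) / 4) < \<gamma> \<and>
      spread_const J * ln x ^ (4 * J) \<le> x powr (\<delta> / 2)"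
    unfolding eventually_at_top_linorder by blast
  have main: "measure M {\<omega>\<in>space M. sup_norm_coeffs p N (random_set N \<xi> \<omega>)
        \<ge> (A + 1) powr (1 / p) * Lp_norm p (\<lambda>x. \<Sum>n\<in>random_set N \<xi> \<omega>. e (real n * x))} \<le> \<gamma>"
    if N: "N0 \<le> real N" and bf: "bernoulli_family (real N powr (- \<delta>)) N M \<xi>"
    for N and M :: "'w measure" and \<xi> :: "nat \<Rightarrow> 'w \<Rightarrow> nat"
  proof -
    interpret prob_space M by (rule bernoulli_familyD[OF bf])
    define R where "R = real N powr (1 - \<delta>)"
    have N2: "2 \<le> N" using N0[OF N] by simp
    have \<tau>: "0 < real N powr (- \<delta>)" "real N powr (- \<delta>) \<le> 1"
      using N2 assms powr_mono[of "- \<delta>" 0 "real N"] by auto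
    have R_eq: "real N powr (- \<delta>) * N = R"
      using N2 powr_add[of "real N" "- \<delta>" 1] by (simp add: R_def add.commute)
    have R1: "1 \<le> R" unfolding R_def using N2 assms by (intro ge_one_powr_ge_zero) auto
    let ?S = "random_set N \<xi>"
    let ?bad = "{\<omega>\<in>space M. \<not> uniform_set R N J (?S \<omega>)} \<union>
      ({\<omega>\<in>space M. 4 * R \<le> card (?S \<omega>)} \<union> {\<omega>\<in>space M. card (?S \<omega>) \<le> R / 4})"
    have good: "sup_norm_coeffs p N S < (A + 1) powr (1 / p) * Lp_norm p (\<lambda>x. \<Sum>n\<in>S. e (real n * x))"
      if S: "S \<subseteq> {1..N}" "uniform_set R N J S" "card S \<le> 4 * R" "R / 4 \<le> card S" for S
    proof -
      define m where "m = (LINT x|unit_lebesgue. cmod (trig_poly S (\<lambda>_. 1) x) powr p)"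
      define T where "T = R powr (p / 2) + R powr p / N"
      have T0: "0 < T" using R1 by (simp add: T_def add_pos_nonneg)
      have Tm: "T \<le> 2 * 8 powr (p + 1) * m"
        unfolding T_def m_def using assms N2 S R1 by (intro moment_ratio_bound) auto
      have upper: "(LINT x|unit_lebesgue. cmod (trig_poly S b x) powr p) \<le> A * m"
        if b: "\<And>n. n \<in> S \<Longrightarrow> cmod (b n) \<le> 1" for b
      proof -
        have "(LINT x|unit_lebesgue. cmod (trig_poly S b x) powr p) \<le> C2 * T"
        \<comment> \<open>For \<open>p = 2\<close> the sum over the levels would lose a logarithm, and Parseval gives the bound directly.\<close>
        proof (cases "p = 2")
          case True
          have "energy (trig_poly S b) = (\<Sum>n\<in>S. (cmod (b n))\<^sup>2)"
            using S(1) finite_subset by (intro energy_trig_poly) blast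
          also have "\<dots> \<le> (\<Sum>n\<in>S. 1)" using b by (intro sum_mono) (auto simp: power_le_one)
          also have "\<dots> \<le> 4 * R" using S(3) by simp
          also have "\<dots> \<le> C2 * T"
            using R1 by (intro mult_mono) (auto simp: C2_def T_def True)
          finally show ?thesis by (simp only: True moment_eq_energy)
        next
          case False
          then have p2: "2 < p" using assms by simp
          have "(LINT x|unit_lebesgue. cmod (trig_poly S b x) powr p) \<le>
            ((2 * B0 ^ 8) powr p + 2 powr (p - 1)
              + C1 * (2 powr (p - 2) / (2 powr (p - 2) - 1)) * 10 powr (p - 2)) * T"
            unfolding T_def
          proof (rule moment_le_of_energy_decay[OF p2 R1 _ _ _ S(3) b])
            show "1 \<le> B0 ^ 8" using B0 by (intro one_le_power) simp
            show "0 \<le> C1" by (simp add: C1_def spread_const_def)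
            show "1 \<le> N" using N2 by simp
            show "energy (large_part (2 ^ i) (trig_poly S b))
                \<le> (2 ^ i)\<^sup>2 * (sqrt R / 2 ^ i) powr (p + 1) + C1 * R\<^sup>2 / real N"
              if "B0 ^ 8 * sqrt R \<le> 2 ^ i" "2 ^ i \<le> 5 * R" for i
              unfolding C1_def
            proof (rule uniform_set_energy_decay[OF assms(1) _ J B0 N2 _ R_def S(1,3,2) b that])
              show "0 \<le> p" using assms by simp
              show "spread_const J * ln (real N) ^ (4 * J) \<le> real N powr (\<delta> / 2)"
                using N0[OF N] by blast
            qed
          qed
          also have "\<dots> \<le> C2 * T" using T0 by (intro mult_right_mono) (auto simp: C2_def)
          finally show ?thesis .
        qed
        also have "\<dots> \<le> C2 * (2 * 8 powr (p + 1) * m)"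
          using Tm by (intro mult_left_mono) (auto simp: C2_def)
        finally show ?thesis by (simp add: A_def mult.assoc)
      qed
      have "0 < 2 * 8 powr (p + 1) * m" using T0 Tm by linarith
      then have m0: "0 < m" by (simp add: zero_less_mult_iff)
      show ?thesis
        by (rule majorant_of_moment_bounds[OF _ _ S(1) upper m_def m0])
          (use assms in \<open>auto simp: A_def C2_def\<close>)
    qed
    have "{\<omega>\<in>space M. sup_norm_coeffs p N (?S \<omega>)
        \<ge> (A + 1) powr (1 / p) * Lp_norm p (\<lambda>x. \<Sum>n\<in>?S \<omega>. e (real n * x))} \<subseteq> ?bad"
    proof (rule subsetI, rule ccontr)
      fix \<omega>
      assume \<omega>: "\<omega> \<in> {\<omega>\<in>space M. sup_norm_coeffs p N (?S \<omega>)
        \<ge> (A + 1) powr (1 / p) * Lp_norm p (\<lambda>x. \<Sum>n\<in>?S \<omega>. e (real n * x))}" and "\<omega> \<notin> ?bad"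
      then have "uniform_set R N J (?S \<omega>)" "card (?S \<omega>) \<le> 4 * R" "R / 4 \<le> card (?S \<omega>)"
        by (simp_all add: not_le)
      from good[OF random_set_subset this] \<omega> show False by simp
    qed
    moreover have meas: "{\<omega>\<in>space M. \<not> uniform_set R N J (?S \<omega>)} \<in> sets M"
      "{\<omega>\<in>space M. 4 * R \<le> card (?S \<omega>)} \<in> sets M" "{\<omega>\<in>space M. card (?S \<omega>) \<le> R / 4} \<in> sets M"
      by (rule sets_random_set[OF bf])+
    ultimately have "measure M {\<omega>\<in>space M. sup_norm_coeffs p N (?S \<omega>)
        \<ge> (A + 1) powr (1 / p) * Lp_norm p (\<lambda>x. \<Sum>n\<in>?S \<omega>. e (real n * x))} \<le> measure M ?bad"
      by (intro finite_measure_mono) auto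
    also have "\<dots> \<le> measure M {\<omega>\<in>space M. \<not> uniform_set R N J (?S \<omega>)} +
      (measure M {\<omega>\<in>space M. 4 * R \<le> card (?S \<omega>)} + measure M {\<omega>\<in>space M. card (?S \<omega>) \<le> R / 4})"
      using meas by (intro order_trans[OF measure_Un_le] add_left_mono measure_Un_le) auto
    also have "\<dots> \<le> 6 * real J / N + (exp (- R) + exp (- R / 4))"
      using uniform_set_fails_prob[OF bf \<tau> N2, of J] card_random_set_prob[OF bf less_imp_le[OF \<tau>(1)] \<tau>(2)]
      unfolding R_eq by (intro add_mono)
    also have "\<dots> \<le> \<gamma>" using N0[OF N] by (simp add: R_def)
    finally show ?thesis .
  qed
  show ?thesis
  proof (rule exI[of _ "(A + 1) powr (1 / p)"], rule exI[of _ N0], intro allI impI)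
    fix M :: "nat \<Rightarrow> 'w measure" and \<xi> :: "nat \<Rightarrow> nat \<Rightarrow> 'w \<Rightarrow> nat"
    assume bf: "\<forall>N\<ge>1. bernoulli_family (real N powr (- \<delta>)) N (M N) (\<xi> N)"
    show "(SUP N\<in>{N. N \<ge> 1 \<and> real N \<ge> N0}. measure (M N) {\<omega>\<in>space (M N).
        sup_norm_coeffs p N (random_set N (\<xi> N) \<omega>) \<ge> (A + 1) powr (1 / p) *
          Lp_norm p (\<lambda>x. \<Sum>n\<in>random_set N (\<xi> N) \<omega>. e (real n * x))}) \<le> \<gamma>"
    proof (rule cSUP_least)
      obtain k :: nat where "N0 \<le> real k" using real_arch_simple by blast
      then have "max 1 k \<in> {N. N \<ge> 1 \<and> real N \<ge> N0}" by auto
      then show "{N. N \<ge> 1 \<and> real N \<ge> N0} \<noteq> {}" by blast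
    qed (use main bf in auto)
  qed
qed

end
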